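(* Let $\varrho$ be a (periodic or aperiodic) primitive inflation rule on $n_a$ prototiles in one dimension, with inflation multiplier $\lambda$, displacement sets $T_{ij}$ and difference sets $S_{ij}=\Lambda_j-\Lambda_i$. For $1\leqslant i,j\leqslant n_a$ let $\Delta_{ij}\subset\mathbb R$ be given point sets such that $\Delta:=\bigcup_{i,j}\Delta_{ij}$ is locally finite and contains $0$. Consider families $(\nu_{ij})_{1\leqslant i,j\leqslant n_a}$ of real-valued functions on $\mathbb R$ with $\operatorname{supp}(\nu_{ij})\subseteq\Delta_{ij}$ that satisfy the linear renormalisation equations $$\nu_{mn}(z)\,=\,\frac1\lambda\sum_{i,j=1}^{n_a}\ \sum_{x\in T_{mi}}\ \sum_{y\in T_{nj}}\nu_{ij}\Bigl(\frac{z+x-y}{\lambda}\Bigr)\qquad(1\leqslant m,n\leqslant n_a).$$ Then the following hold. (1) The (real) vector space of solutions of this type is finite-dimensional. When $S_{ij}\subseteq\Delta_{ij}$ for all $1\leqslant i,j\leqslant n_a$, this solution space is non-trivial. (2) In particular, when $\Delta_{ij}=S_{ij}$ for all $1\leqslant i,j\leqslant n_a$, the solution space is one-dimensional, so there is precisely one solution with $\sum_{i=1}^{n_a}\nu_{ii}(0)=1$, and this solution is strictly positive (that is, $\nu_{ij}(z)>0$ for all $z\in S_{ij}$ and all $i,j$). This solution automatically satisfies the symmetry relation $\nu_{ij}(-z)=\nu_{ji}(z)$ for all $i,j$ and all $z$. (3) If, starting from $\Delta_{ij}=S_{ij}$ for all $i,j$, the set $\Delta_{ij}$ is further restricted to a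 proper subset of $S_{ij}$ for at least one index pair, the solution space becomes trivial.
   Context: Let $\mathcal A=\{a_1,\dots,a_{n_a}\}$ be a finite alphabet and $\varrho$ a primitive substitution on $\mathcal A$: each letter is mapped to a non-empty finite word, and the substitution matrix $M_\varrho=(M_{ij})$, with $M_{ij}$ the number of letters $a_i$ in $\varrho(a_j)$, is primitive. Let $\lambda>1$ be its Perron–Frobenius (PF) eigenvalue, called the inflation multiplier. The associated (geometric) inflation rule, also denoted $\varrho$, uses intervals (prototiles) of natural lengths $\ell_1,\dots,\ell_{n_a}>0$, where $(\ell_1,\dots,\ell_{n_a})$ is a fixed left PF eigenvector of $M_\varrho$; a tile of type $a_i$ is expanded by the factor $\lambda$ and then dissected into tiles of the original sizes in the order specified by the word $\varrho(a_i)$. Tiles of different type but equal length are distinguished by colour. Hull: Starting from a tiling of $\mathbb R$ that is a fixed point of $\varrho$ (or of a suitable power), the hull $\mathbb Y$ is the closure of its translation orbit in the local topology. Each tiling is identified with the coloured point set $\Lambda=\bigcup_{i=1}^{n_a}\Lambda_i$, where $\Lambda_i$ is the set of left endpoints of tiles of type $a_i$ (disjoint union). The system $(\mathbb Y,\mathbb R)$ is strictly ergodic. Displacement sets: $T_{ij}$ is the set of all relative positions (left endpoints, relative to the left endpoint of the patch) of tiles of type $a_i$ in the patch $\varrho(a_j)$, the latter being an interval of length $\lambda\ell_j$ dissected into tiles. $S_{ij}:=\Lambda_j-\Lambda_i=\{y-x\mid y\in\Lambda_j,\ x\in\Lambda_i\}$; this set is the same for every $\Lambda\in\mathbb Y$.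 The rule is called periodic or aperiodic according to whether the elements of $\mathbb Y$ have non-trivial translation periods or not. A set is locally finite if its intersection with every compact set is finite. The support of a function on $\mathbb R$ with locally finite support is the set of points where it is non-zero. *)

theory Defs
  imports "HOL-Analysis.Analysis" "HOL-Library.Function_Algebras"
begin

section \<open>Primitive substitutions and Perron--Frobenius data\<close>

definition substitution_matrix :: "('a::finite \<Rightarrow> 'a list) \<Rightarrow> real^'a^'a" where
  "substitution_matrix \<rho> = (\<chi> i j. real (count_list (\<rho> j) i))"

definition primitive_matrix :: "real^'a^'a::finite \<Rightarrow> bool" where
  "primitive_matrix M \<longleftrightarrow>
     (\<forall>i j. 0 \<le> M $ i $ j) \<and> (\<exists>k\<ge>1. \<forall>i j. 0 < (((**) M ^^ k) (mat 1)) $ i $ j)"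

definition complex_eigenvalue :: "real^'a^'a::finite \<Rightarrow> complex \<Rightarrow> bool" where
  "complex_eigenvalue M \<mu> \<longleftrightarrow>
     (\<exists>v::complex^'a. v \<noteq> 0 \<and> map_matrix complex_of_real M *v v = \<mu> *s v)"

text \<open>For a primitive matrix, the PF eigenvalue is the eigenvalue that strictly dominates
  all other eigenvalues in modulus.\<close>

definition pf_eigenvalue :: "real^'a^'a::finite \<Rightarrow> real \<Rightarrow> bool" where
  "pf_eigenvalue M lam \<longleftrightarrow> complex_eigenvalue M (complex_of_real lam) \<and>
     (\<forall>\<mu>. complex_eigenvalue M \<mu> \<longrightarrow> \<mu> \<noteq> complex_of_real lam \<longrightarrow> norm \<mu> < lam)"

text \<open>The vector \<open>l\<close> of natural tile lengths is a positive left PF eigenvector. The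
  condition \<open>lam > 1\<close> only excludes the trivial substitution \<open>a \<mapsto> a\<close> on one letter.\<close>

definition primitive_inflation :: "('a::finite \<Rightarrow> 'a list) \<Rightarrow> real \<Rightarrow> real^'a \<Rightarrow> bool" where
  "primitive_inflation \<rho> lam l \<longleftrightarrow>
     (\<forall>j. \<rho> j \<noteq> []) \<and>
     primitive_matrix (substitution_matrix \<rho>) \<and>
     pf_eigenvalue (substitution_matrix \<rho>) lam \<and> lam > 1 \<and>
     (\<forall>i. l $ i > 0) \<and>
     l v* substitution_matrix \<rho> = lam *s l"

section \<open>The geometric inflation rule and its hull\<close>

text \<open>A tiling is encoded by the left endpoints of its tiles, sorted by type:
  \<open>\<Lambda> i\<close> is the set of left endpoints of the tiles of type \<open>i\<close>.\<close>

type_synonym 'a pointset = "'a \<Rightarrow> real set"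

definition is_tiling :: "real^'a::finite \<Rightarrow> 'a pointset \<Rightarrow> bool" where
  "is_tiling l \<Lambda> \<longleftrightarrow>
     (\<Union>i. \<Union>x\<in>\<Lambda> i. {x..x + l $ i}) = UNIV \<and>
     (\<forall>i j. \<forall>x\<in>\<Lambda> i. \<forall>y\<in>\<Lambda> j. (i, x) \<noteq> (j, y) \<longrightarrow>
        {x<..<x + l $ i} \<inter> {y<..<y + l $ j} = {})"

definition translate :: "real \<Rightarrow> 'a pointset \<Rightarrow> 'a pointset" where
  "translate t \<Lambda> = (\<lambda>i. (+) t ` \<Lambda> i)"

definition displacements :: "('a::finite \<Rightarrow> 'a list) \<Rightarrow> real^'a \<Rightarrow> 'a \<Rightarrow> 'a \<Rightarrow> real set" where
  "displacements \<rho> l i j =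
     {\<Sum>m<k. l $ (\<rho> j ! m) | k. k < length (\<rho> j) \<and> \<rho> j ! k = i}"

definition inflate ::
  "('a::finite \<Rightarrow> 'a list) \<Rightarrow> real \<Rightarrow> real^'a \<Rightarrow> 'a pointset \<Rightarrow> 'a pointset" where
  "inflate \<rho> lam l \<Lambda> =
     (\<lambda>i. {lam * x + t | j x t. x \<in> \<Lambda> j \<and> t \<in> displacements \<rho> l i j})"

definition supertile ::
  "('a::finite \<Rightarrow> 'a list) \<Rightarrow> real \<Rightarrow> real^'a \<Rightarrow> nat \<Rightarrow> 'a \<Rightarrow> 'a pointset" where
  "supertile \<rho> lam l n j = (inflate \<rho> lam l ^^ n) (\<lambda>i. if i = j then {0} else {})"

text \<open>Legality (every finite patch occurs in some iterate of a single tile) has to be asked for: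
  \<open>a \<mapsto> aba\<close>, \<open>b \<mapsto> bab\<close> also fixes a tiling grown from the seed \<open>a|a\<close>, although
  \<open>aa\<close> occurs in no iterate of a letter, and the orbit closure of that tiling is not minimal.\<close>

definition legal ::
  "('a::finite \<Rightarrow> 'a list) \<Rightarrow> real \<Rightarrow> real^'a \<Rightarrow> 'a pointset \<Rightarrow> bool" where
  "legal \<rho> lam l \<Lambda> \<longleftrightarrow>
     (\<forall>R. \<exists>n j t. \<forall>i. \<Lambda> i \<inter> {-R..R} \<subseteq> translate t (supertile \<rho> lam l n j) i)"

definition inflation_fixed_point ::
  "('a::finite \<Rightarrow> 'a list) \<Rightarrow> real \<Rightarrow> real^'a \<Rightarrow> 'a pointset \<Rightarrow> bool" where
  "inflation_fixed_point \<rho> lam l \<Lambda> \<longleftrightarrow>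
     is_tiling l \<Lambda> \<and> legal \<rho> lam l \<Lambda> \<and> (\<exists>k\<ge>1. (inflate \<rho> lam l ^^ k) \<Lambda> = \<Lambda>)"

text \<open>Two coloured point sets are \<open>\<epsilon>\<close>-close in the local topology if, after a shift by at
  most \<open>\<epsilon>\<close>, they agree on the ball of radius \<open>1/\<epsilon>\<close> around \<open>0\<close>.\<close>

definition locally_close :: "real \<Rightarrow> 'a pointset \<Rightarrow> 'a pointset \<Rightarrow> bool" where
  "locally_close \<epsilon> \<Lambda> \<Lambda>' \<longleftrightarrow>
     (\<exists>s. \<bar>s\<bar> \<le> \<epsilon> \<and> (\<forall>i. \<Lambda>' i \<inter> cball 0 (1/\<epsilon>) = translate s \<Lambda> i \<inter> cball 0 (1/\<epsilon>)))"

definition local_topology :: "'a pointset topology" where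
  "local_topology =
     topology (\<lambda>U. \<forall>\<Lambda>\<in>U. \<exists>\<epsilon>>0. \<forall>\<Lambda>'. locally_close \<epsilon> \<Lambda> \<Lambda>' \<longrightarrow> \<Lambda>' \<in> U)"

definition tiling_hull :: "'a pointset \<Rightarrow> 'a pointset set" where
  "tiling_hull \<Lambda> = local_topology closure_of (range (\<lambda>t. translate t \<Lambda>))"

definition difference_set :: "'a pointset \<Rightarrow> 'a \<Rightarrow> 'a \<Rightarrow> real set" where
  "difference_set \<Lambda> i j = {y - x | x y. x \<in> \<Lambda> i \<and> y \<in> \<Lambda> j}"

lemma locally_close_mono:
  assumes "locally_close \<delta> \<Lambda> \<Lambda>'" "0 < \<delta>" "\<delta> \<le> \<epsilon>"
  shows "locally_close \<epsilon> \<Lambda> \<Lambda>'"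
proof -
  obtain s where s: "\<bar>s\<bar> \<le> \<delta>"
    "\<And>i. \<Lambda>' i \<inter> cball 0 (1/\<delta>) = translate s \<Lambda> i \<inter> cball 0 (1/\<delta>)"
    using assms(1) unfolding locally_close_def by blast
  have "cball (0::real) (1/\<epsilon>) \<subseteq> cball 0 (1/\<delta>)"
    using assms by (intro subset_cball) (simp add: frac_le)
  then have "\<Lambda>' i \<inter> cball 0 (1/\<epsilon>) = translate s \<Lambda> i \<inter> cball 0 (1/\<epsilon>)" for i
    using s(2)[of i] by blast
  then show ?thesis
    unfolding locally_close_def using s(1) assms(3) by (intro exI[of _ s]) auto
qed

lemma openin_local_topology:
  "openin local_topology U \<longleftrightarrow>
     (\<forall>\<Lambda>\<in>U. \<exists>\<epsilon>>0. \<forall>\<Lambda>'. locally_close \<epsilon> \<Lambda> \<Lambda>' \<longrightarrow> \<Lambda>' \<in> U)"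
proof -
  have "istopology (\<lambda>U::'a pointset set.
      \<forall>\<Lambda>\<in>U. \<exists>\<epsilon>>0. \<forall>\<Lambda>'. locally_close \<epsilon> \<Lambda> \<Lambda>' \<longrightarrow> \<Lambda>' \<in> U)" (is "istopology ?P")
    unfolding istopology_def
  proof (intro conjI allI impI)
    fix S T :: "'a pointset set" assume S: "?P S" and T: "?P T"
    show "?P (S \<inter> T)"
    proof
      fix \<Lambda> assume L: "\<Lambda> \<in> S \<inter> T"
      obtain d where d: "d > 0" "\<And>\<Lambda>'. locally_close d \<Lambda> \<Lambda>' \<Longrightarrow> \<Lambda>' \<in> S" using S L by blast
      obtain e where e: "e > 0" "\<And>\<Lambda>'. locally_close e \<Lambda> \<Lambda>' \<Longrightarrow> \<Lambda>' \<in> T" using T L by blast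
      show "\<exists>\<epsilon>>0. \<forall>\<Lambda>'. locally_close \<epsilon> \<Lambda> \<Lambda>' \<longrightarrow> \<Lambda>' \<in> S \<inter> T"
      proof (intro exI[of _ "min d e"] conjI allI impI)
        fix \<Lambda>' assume c: "locally_close (min d e) \<Lambda> \<Lambda>'"
        have "locally_close d \<Lambda> \<Lambda>'" "locally_close e \<Lambda> \<Lambda>'"
          using d(1) e(1) by (auto intro: locally_close_mono[OF c])
        then show "\<Lambda>' \<in> S \<inter> T" using d(2) e(2) by blast
      qed (use d(1) e(1) in auto)
    qed
  next
    fix K :: "'a pointset set set" assume "\<forall>k\<in>K. ?P k"
    then show "?P (\<Union>K)" by (meson UnionE UnionI)
  qed
  then show ?thesis
    unfolding local_topology_def by (simp add: topology_inverse')
qed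

lemma locally_close_refl: "0 < \<epsilon> \<Longrightarrow> locally_close \<epsilon> \<Lambda> \<Lambda>"
  unfolding locally_close_def translate_def by (intro exI[of _ 0]) auto

lemma locally_close_trans:
  assumes c1: "locally_close (\<epsilon>/2) \<Lambda> \<Lambda>'" and c2: "locally_close (\<epsilon>/2) \<Lambda>' \<Lambda>''"
    and e: "0 < \<epsilon>" "\<epsilon> \<le> 1"
  shows "locally_close \<epsilon> \<Lambda> \<Lambda>''"
proof -
  have mem: "x \<in> translate u M i \<longleftrightarrow> x - u \<in> M i" for x u i and M :: "'a pointset"
    unfolding translate_def image_iff by (metis add.commute add_diff_cancel_left' diff_add_cancel)
  obtain s where s: "\<bar>s\<bar> \<le> \<epsilon>/2"
    "\<And>i x. \<bar>x\<bar> \<le> 2/\<epsilon> \<Longrightarrow> x \<in> \<Lambda>' i \<longleftrightarrow> x - s \<in> \<Lambda> i"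
    using c1 unfolding locally_close_def set_eq_iff Int_iff mem by (auto simp: mem_cball)
  obtain s' where s': "\<bar>s'\<bar> \<le> \<epsilon>/2"
    "\<And>i x. \<bar>x\<bar> \<le> 2/\<epsilon> \<Longrightarrow> x \<in> \<Lambda>'' i \<longleftrightarrow> x - s' \<in> \<Lambda>' i"
    using c2 unfolding locally_close_def set_eq_iff Int_iff mem by (auto simp: mem_cball)
  have "x \<in> \<Lambda>'' i \<longleftrightarrow> x - (s + s') \<in> \<Lambda> i" if "\<bar>x\<bar> \<le> 1/\<epsilon>" for x i
  proof -
    have "1 \<le> 1/\<epsilon>" using e by simp
    moreover have "2/\<epsilon> = 1/\<epsilon> + 1/\<epsilon>" by simp
    ultimately have "\<bar>x\<bar> \<le> 2/\<epsilon>" "\<bar>x - s'\<bar> \<le> 2/\<epsilon>"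
      using that s'(1) e by linarith+
    then have "x \<in> \<Lambda>'' i \<longleftrightarrow> x - s' - s \<in> \<Lambda> i" using s'(2) s(2) by blast
    then show ?thesis by (simp add: algebra_simps)
  qed
  then show ?thesis
    unfolding locally_close_def set_eq_iff Int_iff mem using s(1) s'(1)
    by (intro exI[of _ "s + s'"]) (auto simp: mem_cball)
qed

lemma in_tiling_hull_iff:
  "\<Lambda>' \<in> tiling_hull \<Lambda> \<longleftrightarrow> (\<forall>\<epsilon>>0. \<exists>t. locally_close \<epsilon> \<Lambda>' (translate t \<Lambda>))"
proof
  assume h: "\<Lambda>' \<in> tiling_hull \<Lambda>"
  show "\<forall>\<epsilon>>0. \<exists>t. locally_close \<epsilon> \<Lambda>' (translate t \<Lambda>)"
  proof (intro allI impI)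
    fix \<epsilon> :: real assume e: "0 < \<epsilon>"
    define U where "U = {M. \<exists>\<delta>>0. \<forall>M'. locally_close \<delta> M M' \<longrightarrow> locally_close \<epsilon> \<Lambda>' M'}"
    have "openin local_topology U"
      unfolding openin_local_topology
    proof
      fix M assume "M \<in> U"
      then obtain d where d: "d > 0" "\<And>M'. locally_close d M M' \<Longrightarrow> locally_close \<epsilon> \<Lambda>' M'"
        unfolding U_def by blast
      define r where "r = min d 1"
      have r: "0 < r" "r \<le> 1" "r \<le> d" using d(1) by (auto simp: r_def)
      have "M' \<in> U" if "locally_close (r/2) M M'" for M'
        unfolding U_def using r d(2) locally_close_mono[OF locally_close_trans[OF that] r(1,3)]
        by (intro CollectI exI[of _ "r/2"]) auto
      then show "\<exists>\<epsilon>>0. \<forall>M'. locally_close \<epsilon> M M' \<longrightarrow> M' \<in> U"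
        using r by (intro exI[of _ "r/2"]) auto
    qed
    moreover have "\<Lambda>' \<in> U" unfolding U_def using e by blast
    ultimately obtain t where "translate t \<Lambda> \<in> U"
      using h unfolding tiling_hull_def in_closure_of by blast
    then show "\<exists>t. locally_close \<epsilon> \<Lambda>' (translate t \<Lambda>)"
      unfolding U_def using locally_close_refl by blast
  qed
next
  assume h: "\<forall>\<epsilon>>0. \<exists>t. locally_close \<epsilon> \<Lambda>' (translate t \<Lambda>)"
  have "openin local_topology (UNIV :: 'a pointset set)"
    unfolding openin_local_topology using zero_less_one by blast
  then have "\<Lambda>' \<in> topspace local_topology" using openin_subset by blast
  then show "\<Lambda>' \<in> tiling_hull \<Lambda>"
    unfolding tiling_hull_def in_closure_of openin_local_topology using h by blast
qed

section \<open>The renormalisation equations\<close>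

definition locally_finite_set :: "real set \<Rightarrow> bool" where
  "locally_finite_set A \<longleftrightarrow> (\<forall>K. compact K \<longrightarrow> finite (A \<inter> K))"

definition scale_family :: "real \<Rightarrow> ('a \<Rightarrow> 'a \<Rightarrow> real \<Rightarrow> real) \<Rightarrow> 'a \<Rightarrow> 'a \<Rightarrow> real \<Rightarrow> real" where
  "scale_family c \<nu> = (\<lambda>i j z. c * \<nu> i j z)"

interpretation family: vector_space scale_family
  by unfold_locales (auto simp: scale_family_def fun_eq_iff algebra_simps)

definition renormalisation_solutions ::
  "('a::finite \<Rightarrow> 'a list) \<Rightarrow> real \<Rightarrow> real^'a \<Rightarrow> ('a \<Rightarrow> 'a \<Rightarrow> real set) \<Rightarrow>
     ('a \<Rightarrow> 'a \<Rightarrow> real \<Rightarrow> real) set" where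
  "renormalisation_solutions \<rho> lam l \<Delta> =
     {\<nu>. (\<forall>i j. {z. \<nu> i j z \<noteq> 0} \<subseteq> \<Delta> i j) \<and>
         (\<forall>m n z. \<nu> m n z = 1 / lam *
            (\<Sum>i\<in>UNIV. \<Sum>j\<in>UNIV. \<Sum>x\<in>displacements \<rho> l m i. \<Sum>y\<in>displacements \<rho> l n j.
               \<nu> i j ((z + x - y) / lam)))}"

end

theory Submission
  imports Defs
begin

text \<open>Every difference set \<open>S i j\<close> consists of the differences that occur inside supertiles. The
  equations at \<open>z = 0\<close> on the diagonal decouple, because two distinct tiles of one tiling do not
  overlap; they say that \<open>(\<nu> i i 0)\<^sub>i\<close> is a right PF eigenvector. Iterating the renormalisation
  operator on such an eigenvector, placed on the diagonal, gives a bounded increasing sequence whose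
  limit is a solution that is positive on all of \<open>S\<close>. A solution with vanishing diagonal is zero: in
  the \<open>N\<close>-fold iterated equation only boundedly many terms survive, while the prefactor is
  \<open>1 / lam ^ N\<close>. For general \<open>\<Delta>\<close> the iterated equation shows that a solution is determined by its
  values on a bounded window.\<close>

text \<open>The functions \<open>\<nu> i j\<close> model pair frequencies: how often a tile of type
  i has a tile of type j at offset z. If \<open>r $ i / lam ^ N\<close> is read as the frequency of
  level-N supertiles of type i, then the N-th iterate on \<open>diagonal r\<close> counts exactly
  those pairs that share a level-N supertile. This explains why the iterates increase, stay below
  \<open>r $ m\<close>, and become positive once some supertile contains the pair.

  The delicate point of uniqueness is the scale of the prefactor. Supertiles of level N hold of the
  order of \<open>lam ^ N\<close> tiles, so the pairs inside a common supertile (equal types,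
  argument 0) just balance \<open>1 / lam ^ N\<close>. All other terms must be shown not to grow in
  number. That rests on two properties of the difference sets, a gap around 0 and finiteness on
  bounded intervals; both are read off from a tiling and then carried over to the
  supertiles.\<close>

lemma scale_family_apply: "scale_family c \<nu> i j z = c * \<nu> i j z"
  by (simp add: scale_family_def)

text \<open>Each point evaluation is a linear functional, so its kernel has codimension at most one
  in V. Induction over F passes to the kernel and restores a single vector u on which the evaluation
  does not vanish.\<close>

lemma finite_span_if_determined_on_finite:
  fixes V :: "('a \<Rightarrow> 'a \<Rightarrow> real \<Rightarrow> real) set"
  assumes "finite F" and "family.subspace V"
    and "\<And>\<nu>. \<nu> \<in> V \<Longrightarrow> \<forall>(i, j, z)\<in>F. \<nu> i j z = 0 \<Longrightarrow> \<nu> = 0"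
  shows "\<exists>B. finite B \<and> family.span B = V"
  using assms
proof (induction F arbitrary: V)
  case empty
  have "\<nu> = 0" if "\<nu> \<in> V" for \<nu>
    using that by (rule empty.prems(2)) simp
  then have "V = {0}" using family.subspace_0[OF empty.prems(1)] by blast
  then show ?case by (intro exI[of _ "{}"]) simp
next
  case (insert p F)
  obtain i j z where p: "p = (i, j, z)" by (metis prod_cases3)
  define V' where "V' = {\<nu> \<in> V. \<nu> i j z = 0}"
  have "family.subspace V'"
  proof (rule family.subspaceI)
    show "0 \<in> V'"
      using family.subspace_0[OF insert.prems(1)] by (simp add: V'_def)
    show "\<mu> + \<nu> \<in> V'" if "\<mu> \<in> V'" "\<nu> \<in> V'" for \<mu> \<nu>
      using family.subspace_add[OF insert.prems(1), of \<mu> \<nu>] that by (simp add: V'_def)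
    show "scale_family c \<nu> \<in> V'" if "\<nu> \<in> V'" for c \<nu>
      using family.subspace_scale[OF insert.prems(1), of \<nu> c] that
      by (simp add: V'_def scale_family_apply)
  qed
  moreover have "\<nu> = 0" if "\<nu> \<in> V'" "\<forall>(i, j, z)\<in>F. \<nu> i j z = 0" for \<nu>
  proof (rule insert.prems(2))
    show "\<nu> \<in> V" using that(1) by (simp add: V'_def)
    show "\<forall>(i, j, z)\<in>insert p F. \<nu> i j z = 0" using that by (simp add: V'_def p)
  qed
  ultimately have "\<exists>B. finite B \<and> family.span B = V'"
    by (rule insert.IH)
  then obtain B where B: "finite B" "family.span B = V'" by blast
  show ?case
  proof (cases "V' = V")
    case False
    then obtain u where u: "u \<in> V" "u i j z \<noteq> 0" by (auto simp: V'_def)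
    have "family.span (insert u B) = V"
    proof
      have "B \<subseteq> V" using B(2) family.span_superset[of B] by (auto simp: V'_def)
      then show "family.span (insert u B) \<subseteq> V"
        using u(1) insert.prems(1) by (intro family.span_minimal) auto
      show "V \<subseteq> family.span (insert u B)"
      proof
        fix \<nu> assume \<nu>: "\<nu> \<in> V"
        have "\<nu> - scale_family (\<nu> i j z / u i j z) u \<in> V"
          using insert.prems(1) \<nu> u(1) by (intro family.subspace_diff family.subspace_scale)
        then have "\<nu> - scale_family (\<nu> i j z / u i j z) u \<in> family.span B"
          unfolding B(2) V'_def using u(2) by (simp add: scale_family_apply)
        then show "\<nu> \<in> family.span (insert u B)"
          unfolding family.span_breakdown_eq by blast
      qed
    qed
    then show ?thesis using B(1) by (intro exI[of _ "insert u B"]) simp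
  qed (use B in blast)
qed

section \<open>Supertiles\<close>

lemma count_list_eq_card: "count_list xs a = card {k. k < length xs \<and> xs ! k = a}"
  by (simp add: count_list_eq_length_filter length_filter_conv_card eq_commute)

lemma sum_nth_eq_sum_count_list:
  fixes f :: "'a::finite \<Rightarrow> real"
  shows "(\<Sum>m<length xs. f (xs ! m)) = (\<Sum>i\<in>UNIV. real (count_list xs i) * f i)"
proof -
  have "(\<Sum>m<length xs. f (xs ! m)) = (\<Sum>i\<in>UNIV. \<Sum>m\<in>{m\<in>{..<length xs}. xs ! m = i}. f (xs ! m))"
    by (rule sum.group[symmetric]) auto
  also have "\<dots> = (\<Sum>i\<in>UNIV. real (count_list xs i) * f i)"
    by (intro sum.cong refl) (simp add: count_list_eq_card)
  finally show ?thesis .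
qed

locale inflation_rule =
  fixes \<rho> :: "'a::finite \<Rightarrow> 'a list" and lam :: real and l :: "real^'a"
  assumes inflation: "primitive_inflation \<rho> lam l"
begin

abbreviation T :: "'a \<Rightarrow> 'a \<Rightarrow> real set" where "T \<equiv> displacements \<rho> l"
abbreviation P :: "nat \<Rightarrow> 'a \<Rightarrow> 'a pointset" where "P \<equiv> supertile \<rho> lam l"
abbreviation M :: "real^'a^'a" where "M \<equiv> substitution_matrix \<rho>"

lemma lam_gt_1: "lam > 1" and l_pos [simp]: "l $ i > 0" and word_nonempty: "\<rho> j \<noteq> []"
  using inflation by (auto simp: primitive_inflation_def)

lemma lam_pos [simp]: "lam > 0" "lam \<noteq> 0" "lam \<ge> 0"
  using lam_gt_1 by auto

lemma l_nonneg [simp]: "0 \<le> l $ i"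
  using less_imp_le[OF l_pos] .

lemma word_length: "(\<Sum>m<length (\<rho> j). l $ (\<rho> j ! m)) = lam * l $ j"
proof -
  have "(l v* M) $ j = (lam *s l) $ j"
    using inflation by (simp add: primitive_inflation_def)
  then show ?thesis
    by (simp add: sum_nth_eq_sum_count_list vector_matrix_mult_def substitution_matrix_def
        mult.commute)
qed

lemma displacement_bounds:
  assumes "t \<in> T i j"
  shows "0 \<le> t" "t + l $ i \<le> lam * l $ j"
proof -
  obtain k where k: "t = (\<Sum>m<k. l $ (\<rho> j ! m))" "k < length (\<rho> j)" "\<rho> j ! k = i"
    using assms by (auto simp: displacements_def)
  show "0 \<le> t" unfolding k(1) by (intro sum_nonneg) simp
  have "t + l $ i = (\<Sum>m<Suc k. l $ (\<rho> j ! m))" using k by simp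
  also have "\<dots> \<le> (\<Sum>m<length (\<rho> j). l $ (\<rho> j ! m))"
    using k(2) by (intro sum_mono2) auto
  finally show "t + l $ i \<le> lam * l $ j" by (simp add: word_length)
qed

lemma displacements_eq_image:
  "T i j = (\<lambda>k. \<Sum>m<k. l $ (\<rho> j ! m)) ` {k. k < length (\<rho> j) \<and> \<rho> j ! k = i}"
  by (auto simp: displacements_def)

lemma finite_displacements: "finite (T i j)"
  by (simp add: displacements_eq_image)

text \<open>Tile lengths are positive, so partial sums along the word increase strictly and
  different occurrences of a letter have different displacements. Sums over \<open>T i j\<close>
  therefore count with the right multiplicity.\<close>

lemma card_displacements: "real (card (T i j)) = M $ i $ j"
proof -
  have "strict_mono (\<lambda>k. \<Sum>m<k. l $ (\<rho> j ! m))"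
    by (intro strict_mono_Suc_iff[THEN iffD2]) simp
  then have "inj_on (\<lambda>k. \<Sum>m<k. l $ (\<rho> j ! m)) A" for A
    by (meson strict_mono_on_imp_inj_on strict_mono_on_def strict_mono_def inj_on_subset subset_UNIV)
  then show ?thesis
    by (simp add: displacements_eq_image card_image substitution_matrix_def count_list_eq_card)
qed

lemma supertile_0: "P 0 j i = (if i = j then {0} else {})"
  by (simp add: supertile_def)

lemma supertile_Suc: "P (Suc n) j i = {lam * x + t | k x t. x \<in> P n j k \<and> t \<in> T i k}"
  by (simp add: supertile_def inflate_def)

lemma supertile_Suc_UN: "P (Suc n) j i = (\<Union>k. \<Union>t\<in>T i k. (\<lambda>x. lam * x + t) ` P n j k)"
  unfolding supertile_Suc by auto

lemma supertile_1: "P 1 j i = T i j"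
  by (auto simp: supertile_Suc supertile_0 split: if_splits)

text \<open>The n-th power of the rule is again such a rule, with multiplier \<open>lam ^ n\<close>
  and the supertile positions as displacement sets. This allows the iterated equations to be written
  in closed form.\<close>

lemma inflate_funpow:
  "(inflate \<rho> lam l ^^ n) \<Lambda> i = {lam ^ n * x + s | j x s. x \<in> \<Lambda> j \<and> s \<in> P n j i}"
proof (induction n arbitrary: i)
  case 0
  show ?case by (auto simp: supertile_0 split: if_splits)
next
  case (Suc n)
  have "(inflate \<rho> lam l ^^ Suc n) \<Lambda> i
      = {lam * y + t | k y t. y \<in> (inflate \<rho> lam l ^^ n) \<Lambda> k \<and> t \<in> T i k}"
    by (simp add: inflate_def)
  also have "\<dots> = {lam ^ Suc n * x + s | j x s. x \<in> \<Lambda> j \<and> s \<in> P (Suc n) j i}" (is "?A = ?B")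
  proof
    show "?A \<subseteq> ?B"
    proof
      fix z assume "z \<in> ?A"
      then obtain k j x s t where "x \<in> \<Lambda> j" "s \<in> P n j k" "t \<in> T i k"
          "z = lam * (lam ^ n * x + s) + t"
        unfolding Suc.IH by blast
      then show "z \<in> ?B"
        unfolding supertile_Suc
        by (intro CollectI exI[of _ j] exI[of _ x] exI[of _ "lam * s + t"])
          (auto simp: distrib_left mult.assoc)
    qed
    show "?B \<subseteq> ?A"
    proof
      fix z assume "z \<in> ?B"
      then obtain k j x s t where *: "x \<in> \<Lambda> j" "s \<in> P n j k" "t \<in> T i k"
          "z = lam ^ Suc n * x + (lam * s + t)"
        unfolding supertile_Suc by blast
      then show "z \<in> ?A"
        unfolding Suc.IH
        by (intro CollectI exI[of _ k] exI[of _ "lam ^ n * x + s"] exI[of _ t])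
          (auto simp: algebra_simps)
    qed
  qed
  finally show ?case .
qed

lemma supertile_add:
  "P (n + p) a i = {lam ^ n * s + x | k s x. s \<in> P p a k \<and> x \<in> P n k i}"
proof -
  have "P (n + p) a i = (inflate \<rho> lam l ^^ n) (P p a) i"
    by (simp add: supertile_def funpow_add)
  then show ?thesis by (simp add: inflate_funpow)
qed

lemma finite_supertile: "finite (P n j i)"
  by (induction n arbitrary: i) (auto simp: supertile_0 supertile_Suc_UN finite_displacements)

lemma supertile_bounds:
  assumes "x \<in> P n j i"
  shows "0 \<le> x" "x + l $ i \<le> lam ^ n * l $ j"
proof -
  have "0 \<le> x \<and> x + l $ i \<le> lam ^ n * l $ j"
    using assms
  proof (induction n arbitrary: i x)
    case 0
    then show ?case by (auto simp: supertile_0 split: if_splits)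
  next
    case (Suc n)
    then obtain k y t where k: "x = lam * y + t" "y \<in> P n j k" "t \<in> T i k"
      by (auto simp: supertile_Suc)
    have "lam * (y + l $ k) \<le> lam * (lam ^ n * l $ j)"
      using Suc.IH[OF k(2)] by (intro mult_left_mono) auto
    then show ?case
      using Suc.IH[OF k(2)] displacement_bounds[OF k(3)] k(1)
      by (auto simp: algebra_simps)
  qed
  then show "0 \<le> x" "x + l $ i \<le> lam ^ n * l $ j" by auto
qed

lemma matrix_power_supertile:
  "(((**) M ^^ q) (mat 1)) $ i $ j \<noteq> 0 \<Longrightarrow> P q j i \<noteq> {}"
proof (induction q arbitrary: i)
  case 0
  then show ?case by (auto simp: mat_def supertile_0 split: if_splits)
next
  case (Suc q)
  then have "(\<Sum>k\<in>UNIV. M $ i $ k * (((**) M ^^ q) (mat 1)) $ k $ j) \<noteq> 0"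
    by (simp add: matrix_matrix_mult_def[of M "((**) M ^^ q) (mat 1)"])
  then obtain k where k: "M $ i $ k \<noteq> 0" "(((**) M ^^ q) (mat 1)) $ k $ j \<noteq> 0"
    using sum.not_neutral_contains_not_neutral by (metis (no_types, lifting) mult_eq_0_iff)
  have "T i k \<noteq> {}" using k(1) by (auto simp flip: card_displacements)
  then show ?case using Suc.IH[OF k(2)] by (auto simp: supertile_Suc)
qed

lemma primitive: obtains q where "\<And>i j. 0 < (((**) M ^^ q) (mat 1)) $ i $ j"
  using inflation unfolding primitive_inflation_def primitive_matrix_def by blast

text \<open>Primitivity provides a single level q. All higher levels are covered as well, which
  matters because the fixed point later dictates which levels may be used.\<close>

lemma supertile_contains_all_types: obtains q where "\<And>p i j. p \<ge> q \<Longrightarrow> P p j i \<noteq> {}"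
proof -
  obtain q where q: "\<And>i j. 0 < (((**) M ^^ q) (mat 1)) $ i $ j"
    using primitive by blast
  have "P p j i \<noteq> {}" if "p \<ge> q" for p i j
    using that
  proof (induction p arbitrary: j rule: dec_induct)
    case base
    show ?case using matrix_power_supertile q less_numeral_extra(3) by metis
  next
    case (step p)
    \<comment> \<open>The first letter of the word has displacement 0, so a supertile of level p + 1
      contains the level-p supertile of that letter.\<close>
    have "(\<Sum>m<0. l $ (\<rho> j ! m)) \<in> T (\<rho> j ! 0) j"
      unfolding displacements_def using word_nonempty[of j] by blast
    then show ?case
      using step.IH supertile_add[of p 1 j i] unfolding supertile_1 by fastforce
  qed
  then show thesis using that by blast
qed

text \<open>A description of the difference sets that mentions no tiling; it serves as the common
  value for the fixed point and all elements of its hull.\<close>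

definition supertile_differences :: "'a \<Rightarrow> 'a \<Rightarrow> real set" where
  "supertile_differences i j = {y - x | n k x y. x \<in> P n k i \<and> y \<in> P n k j}"

lemma supertile_differencesI:
  "x \<in> P n k i \<Longrightarrow> y \<in> P n k j \<Longrightarrow> y - x \<in> supertile_differences i j"
  unfolding supertile_differences_def by blast

section \<open>Perron--Frobenius eigenvectors\<close>

lemma matrix_nonneg: "0 \<le> M $ i $ j"
  by (simp flip: card_displacements)

lemma matrix_power_eigenvector:
  assumes "M *v v = lam *s v"
  shows "((**) M ^^ q) (mat 1) *v v = lam ^ q *s v"
  by (induction q)
    (simp_all add: matrix_vector_mul_assoc[symmetric] assms vec.scale ac_simps)

text \<open>A strictly positive power of M spreads the one positive entry to every coordinate, and
  on v that power only rescales.\<close>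

lemma nonneg_eigenvector_pos:
  assumes ev: "M *v v = lam *s v" and nonneg: "\<And>i. 0 \<le> v $ i" and pos: "v $ k > 0"
  shows "v $ i > 0"
proof -
  obtain q where q: "\<And>i j. 0 < (((**) M ^^ q) (mat 1)) $ i $ j"
    using primitive by blast
  let ?B = "((**) M ^^ q) (mat 1)"
  have "0 < (\<Sum>j\<in>UNIV. ?B $ i $ j * v $ j)"
    using q nonneg pos by (intro sum_pos2[of _ k]) (auto intro: mult_nonneg_nonneg less_imp_le)
  also have "\<dots> = (?B *v v) $ i"
    by (simp add: matrix_vector_mult_def)
  also have "\<dots> = lam ^ q * v $ i"
    by (simp add: matrix_power_eigenvector[OF ev])
  finally show ?thesis by (rule zero_less_mult_pos) simp
qed

text \<open>Subtract from d the largest multiple of r that keeps the difference non-negative. The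
  difference is an eigenvector with a zero entry, so a positive entry elsewhere would contradict
  \<open>nonneg_eigenvector_pos\<close>.\<close>

lemma eigenvector_unique:
  assumes r: "M *v r = lam *s r" "\<And>i. r $ i > 0" and d: "M *v d = lam *s d"
  obtains c where "d = c *s r"
proof -
  define c where "c = Min (range (\<lambda>i. d $ i / r $ i))"
  have "c \<in> range (\<lambda>i. d $ i / r $ i)" unfolding c_def by (intro Min_in) auto
  then obtain k where k: "c = d $ k / r $ k" by auto
  have "c \<le> d $ i / r $ i" for i unfolding c_def by (intro Min_le) auto
  then have nonneg: "0 \<le> (d - c *s r) $ i" for i
    unfolding pos_le_divide_eq[OF r(2)] by simp
  have "M *v (d - c *s r) = lam *s (d - c *s r)"
    by (simp add: vec.diff vec.scale r(1) d vec_eq_iff algebra_simps)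
  moreover have "(d - c *s r) $ k = 0" using r(2)[of k] by (simp add: k)
  ultimately have "(d - c *s r) $ i = 0" for i
    using nonneg_eigenvector_pos[of "d - c *s r" i k] nonneg[of i] nonneg by fastforce
  then have "d = c *s r" by (simp add: vec_eq_iff)
  then show thesis using that by blast
qed

text \<open>M and lam are real, so real and imaginary parts of a complex eigenvector satisfy the
  equation separately, and they do not both vanish.\<close>

lemma real_eigenvector: obtains v :: "real^'a" where "v \<noteq> 0" "M *v v = lam *s v"
proof -
  obtain w :: "complex^'a" where w: "w \<noteq> 0" "map_matrix complex_of_real M *v w = of_real lam *s w"
    using inflation unfolding primitive_inflation_def pf_eigenvalue_def complex_eigenvalue_def
    by blast
  have *: "(\<Sum>j\<in>UNIV. complex_of_real (M $ i $ j) * w $ j) = of_real lam * w $ i" for i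
    using arg_cong[OF w(2), of "\<lambda>v. v $ i"]
    by (simp add: matrix_vector_mult_def map_matrix_def)
  have "M *v (\<chi> i. Re (w $ i)) = lam *s (\<chi> i. Re (w $ i))"
    using arg_cong[OF *, of Re] by (simp add: vec_eq_iff matrix_vector_mult_def)
  moreover have "M *v (\<chi> i. Im (w $ i)) = lam *s (\<chi> i. Im (w $ i))"
    using arg_cong[OF *, of Im] by (simp add: vec_eq_iff matrix_vector_mult_def)
  moreover have "(\<chi> i. Re (w $ i)) \<noteq> 0 \<or> (\<chi> i. Im (w $ i)) \<noteq> 0"
    using w(1) by (auto simp: vec_eq_iff complex_eq_iff)
  ultimately show thesis using that by blast
qed

text \<open>The modulus of a real eigenvector is a subinvariant vector; pairing it with the positive
  left eigenvector \<open>l\<close> forces equality.\<close>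

lemma positive_eigenvector:
  obtains r :: "real^'a" where "\<And>i. r $ i > 0" "M *v r = lam *s r"
proof -
  obtain v :: "real^'a" where v: "v \<noteq> 0" "M *v v = lam *s v"
    using real_eigenvector by blast
  define a where "a = (\<chi> i. \<bar>v $ i\<bar>)"
  have le: "lam * a $ i \<le> (\<Sum>j\<in>UNIV. M $ i $ j * a $ j)" for i
  proof -
    have "lam * a $ i = \<bar>(M *v v) $ i\<bar>"
      by (simp add: v(2) a_def abs_mult)
    also have "\<dots> \<le> (\<Sum>j\<in>UNIV. \<bar>M $ i $ j * v $ j\<bar>)"
      by (simp add: matrix_vector_mult_def)
    also have "\<dots> = (\<Sum>j\<in>UNIV. M $ i $ j * a $ j)"
      by (simp add: a_def abs_mult matrix_nonneg)
    finally show ?thesis .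
  qed
  have "l v* M = lam *s l"
    using inflation by (simp add: primitive_inflation_def)
  then have l: "(\<Sum>i\<in>UNIV. l $ i * M $ i $ j) = lam * l $ j" for j
    by (metis (no_types, lifting) vector_matrix_mult_def vector_smult_component vec_lambda_beta
        sum.cong mult.commute)
  have "(\<Sum>i\<in>UNIV. l $ i * (\<Sum>j\<in>UNIV. M $ i $ j * a $ j))
      = (\<Sum>j\<in>UNIV. (\<Sum>i\<in>UNIV. l $ i * M $ i $ j) * a $ j)"
    unfolding sum_distrib_left sum_distrib_right by (subst sum.swap) (simp add: mult.assoc)
  also have "\<dots> = (\<Sum>j\<in>UNIV. l $ j * (lam * a $ j))"
    by (simp add: l ac_simps)
  finally have "(\<Sum>i\<in>UNIV. l $ i * ((\<Sum>j\<in>UNIV. M $ i $ j * a $ j) - lam * a $ i)) = 0"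
    by (simp add: right_diff_distrib sum_subtractf)
  then have zero: "l $ i * ((\<Sum>j\<in>UNIV. M $ i $ j * a $ j) - lam * a $ i) = 0" for i
    using sum_nonneg_eq_0_iff[of UNIV "\<lambda>i. l $ i * ((\<Sum>j\<in>UNIV. M $ i $ j * a $ j) - lam * a $ i)"] le
    by simp
  have "(\<Sum>j\<in>UNIV. M $ i $ j * a $ j) = lam * a $ i" for i
    using zero[of i] less_imp_neq[OF l_pos[of i]] unfolding mult_eq_0_iff by linarith
  then have ev: "M *v a = lam *s a"
    by (simp add: vec_eq_iff matrix_vector_mult_def)
  obtain k where "v $ k \<noteq> 0" using v(1) by (auto simp: vec_eq_iff)
  then have "a $ i > 0" for i
    using nonneg_eigenvector_pos[OF ev, of k i] by (simp add: a_def)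
  then show thesis using that ev by blast
qed

end

section \<open>Difference sets of tilings in the hull\<close>

lemma mem_translate: "x \<in> translate t \<Lambda> i \<longleftrightarrow> x - t \<in> \<Lambda> i"
  unfolding translate_def image_iff by (metis add.commute add_diff_cancel_left' diff_add_cancel)

lemma difference_setI: "x \<in> \<Lambda> i \<Longrightarrow> y \<in> \<Lambda> j \<Longrightarrow> y - x \<in> difference_set \<Lambda> i j"
  unfolding difference_set_def by blast

lemma difference_setE:
  assumes "z \<in> difference_set \<Lambda> i j"
  obtains x y where "z = y - x" "x \<in> \<Lambda> i" "y \<in> \<Lambda> j"
  using assms unfolding difference_set_def by blast

lemma difference_set_uminus: "- z \<in> difference_set \<Lambda> i j \<longleftrightarrow> z \<in> difference_set \<Lambda> j i"
proof -
  have "- z \<in> difference_set \<Lambda> i j" if z: "z \<in> difference_set \<Lambda> j i" for z i j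
  proof -
    obtain x y where "z = y - x" "x \<in> \<Lambda> j" "y \<in> \<Lambda> i"
      using z by (rule difference_setE)
    then show ?thesis using difference_setI[of y \<Lambda> i x j] by simp
  qed
  from this[of z j i] this[of "- z" i j] show ?thesis by auto
qed

lemma locally_close_iff:
  "locally_close \<epsilon> \<Lambda> \<Lambda>' \<longleftrightarrow>
     (\<exists>s. \<bar>s\<bar> \<le> \<epsilon> \<and> (\<forall>i x. \<bar>x\<bar> \<le> 1/\<epsilon> \<longrightarrow> (x \<in> \<Lambda>' i \<longleftrightarrow> x - s \<in> \<Lambda> i)))"
  unfolding locally_close_def set_eq_iff Int_iff mem_translate by (auto simp: mem_cball)

locale inflation_tiling = inflation_rule +
  fixes \<Lambda>\<^sub>0 :: "'a::finite pointset"
  assumes fixed_point: "inflation_fixed_point \<rho> lam l \<Lambda>\<^sub>0"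
begin

lemma tiling: "is_tiling l \<Lambda>\<^sub>0" and legal: "legal \<rho> lam l \<Lambda>\<^sub>0"
  using fixed_point by (auto simp: inflation_fixed_point_def)

lemma tiling_covers: obtains i x where "x \<in> \<Lambda>\<^sub>0 i" "x \<le> p" "p \<le> x + l $ i"
proof -
  have "p \<in> (\<Union>i. \<Union>x\<in>\<Lambda>\<^sub>0 i. {x..x + l $ i})"
    using tiling by (simp add: is_tiling_def)
  then show thesis using that by auto
qed

lemma tiling_disjoint:
  assumes "x \<in> \<Lambda>\<^sub>0 i" "y \<in> \<Lambda>\<^sub>0 j"
  shows "(i = j \<and> x = y) \<or> x + l $ i \<le> y \<or> y + l $ j \<le> x"
proof (rule ccontr)
  assume *: "\<not> ?thesis"
  then have "{x<..<x + l $ i} \<inter> {y<..<y + l $ j} = {}"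
    using tiling assms unfolding is_tiling_def by auto
  moreover have "max x y < min (x + l $ i) (y + l $ j)"
    using * by auto
  then obtain p where "max x y < p" "p < min (x + l $ i) (y + l $ j)"
    using dense by blast
  ultimately show False by auto
qed

text \<open>A gap after the tile would be shorter than every tile, yet the tile covering a point of
  the gap would have to fit into it.\<close>

lemma tiling_successor:
  assumes x: "x \<in> \<Lambda>\<^sub>0 i"
  shows "\<exists>j. x + l $ i \<in> \<Lambda>\<^sub>0 j"
proof -
  define \<delta> where "\<delta> = Min (range (($) l))"
  have \<delta>: "\<delta> > 0" "\<And>j. \<delta> \<le> l $ j"
    by (auto simp: \<delta>_def)
  have later: "x + l $ i \<le> y" if "y \<in> \<Lambda>\<^sub>0 j" "x + l $ i < p" "p \<le> y + l $ j" for y j p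
    using tiling_disjoint[OF x that(1)] that(2,3) l_pos[of i] by (smt (verit))
  \<comment> \<open>The end point of the tile is covered by the tile itself, so the search starts
    slightly beyond it; \<open>\<delta>/2\<close> is less than any tile length.\<close>
  obtain j y where y: "y \<in> \<Lambda>\<^sub>0 j" "y \<le> x + l $ i + \<delta>/2" "x + l $ i + \<delta>/2 \<le> y + l $ j"
    by (rule tiling_covers)
  have ge: "x + l $ i \<le> y" using later[OF y(1) _ y(3)] \<delta>(1) by simp
  have "\<not> x + l $ i < y"
  proof
    assume "x + l $ i < y"
    then obtain p where p: "x + l $ i < p" "p < y" using dense by blast
    obtain k u where u: "u \<in> \<Lambda>\<^sub>0 k" "u \<le> p" "p \<le> u + l $ k"
      by (rule tiling_covers)
    have "x + l $ i \<le> u" using later[OF u(1) p(1) u(3)] .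
    moreover have "u + l $ k \<le> y"
      using tiling_disjoint[OF u(1) y(1)] u(2) p(2) l_pos[of j] by argo
    ultimately show False
      using y(2) \<delta>(1) \<delta>(2)[of k] by argo
  qed
  with ge have "x + l $ i = y" by simp
  then show ?thesis using y(1) by auto
qed

lemma difference_set_disjoint:
  assumes "z \<in> difference_set \<Lambda>\<^sub>0 i j"
  shows "(i = j \<and> z = 0) \<or> l $ i \<le> z \<or> z \<le> - l $ j"
  using assms tiling_disjoint unfolding difference_set_def by fastforce

text \<open>Passing to the right neighbour shortens a positive difference by at least the smallest
  tile length \<open>\<delta>\<close>. A difference in \<open>{0..real n * \<delta>}\<close> thus
  takes at most n such moves, each with finitely many choices of type; negative ones follow by
  reflection.\<close>

lemma finite_difference_set_Icc: "finite (difference_set \<Lambda>\<^sub>0 i j \<inter> {-Z..Z})"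
proof -
  define \<delta> where "\<delta> = Min (range (($) l))"
  have \<delta>: "\<delta> > 0" "\<And>j. \<delta> \<le> l $ j"
    by (auto simp: \<delta>_def)
  have fin: "finite (difference_set \<Lambda>\<^sub>0 i j \<inter> {0..real n * \<delta>})" for n i j
  proof (induction n arbitrary: i)
    case 0
    have "{0..real 0 * \<delta>} = {0}" by auto
    then show ?case by (metis finite.emptyI finite_Int finite_insert)
  next
    case (Suc n)
    have "difference_set \<Lambda>\<^sub>0 i j \<inter> {0..real (Suc n) * \<delta>}
        \<subseteq> insert 0 (\<Union>k. (+) (l $ i) ` (difference_set \<Lambda>\<^sub>0 k j \<inter> {0..real n * \<delta>}))"
    proof
      fix z assume z: "z \<in> difference_set \<Lambda>\<^sub>0 i j \<inter> {0..real (Suc n) * \<delta>}"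
      then obtain x y where xy: "z = y - x" "x \<in> \<Lambda>\<^sub>0 i" "y \<in> \<Lambda>\<^sub>0 j"
        by (meson IntD1 difference_setE)
      obtain k where k: "x + l $ i \<in> \<Lambda>\<^sub>0 k" using tiling_successor[OF xy(2)] by blast
      have "z = 0 \<or> l $ i \<le> z"
        using difference_set_disjoint[of z i j] z l_pos[of j] by (auto simp del: l_pos)
      then consider "z = 0" | "l $ i \<le> z" by blast
      then show "z \<in> insert 0 (\<Union>k. (+) (l $ i) ` (difference_set \<Lambda>\<^sub>0 k j \<inter> {0..real n * \<delta>}))"
      proof cases
        case 2
        have "z - l $ i \<in> difference_set \<Lambda>\<^sub>0 k j"
          using difference_setI[of _ \<Lambda>\<^sub>0, OF k xy(3)] by (simp add: xy(1) algebra_simps)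
        moreover have "z - l $ i \<in> {0..real n * \<delta>}"
          using 2 z \<delta>(2)[of i] by (auto simp: algebra_simps)
        ultimately have "z \<in> (+) (l $ i) ` (difference_set \<Lambda>\<^sub>0 k j \<inter> {0..real n * \<delta>})"
          by (intro image_eqI[of _ _ "z - l $ i"]) auto
        then show ?thesis by blast
      qed simp
    qed
    then show ?case by (rule finite_subset) (use Suc.IH in auto)
  qed
  obtain n where n: "Z \<le> real n * \<delta>"
    using reals_Archimedean3[OF \<delta>(1)] less_imp_le by blast
  have "difference_set \<Lambda>\<^sub>0 i j \<inter> {-Z..Z}
      \<subseteq> (difference_set \<Lambda>\<^sub>0 i j \<inter> {0..real n * \<delta>})
        \<union> uminus ` (difference_set \<Lambda>\<^sub>0 j i \<inter> {0..real n * \<delta>})"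
  proof
    fix z assume z: "z \<in> difference_set \<Lambda>\<^sub>0 i j \<inter> {-Z..Z}"
    show "z \<in> (difference_set \<Lambda>\<^sub>0 i j \<inter> {0..real n * \<delta>})
        \<union> uminus ` (difference_set \<Lambda>\<^sub>0 j i \<inter> {0..real n * \<delta>})"
    proof (cases "z \<ge> 0")
      case False
      then have "- z \<in> difference_set \<Lambda>\<^sub>0 j i \<inter> {0..real n * \<delta>}"
        using z n by (auto simp: difference_set_uminus)
      then have "z \<in> uminus ` (difference_set \<Lambda>\<^sub>0 j i \<inter> {0..real n * \<delta>})"
        by (intro image_eqI[of _ _ "- z"]) auto
      then show ?thesis by blast
    qed (use z n in auto)
  qed
  then show ?thesis by (rule finite_subset) (use fin in auto)
qed

section \<open>Recurrence of supertile differences and their transfer to the hull\<close>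

lemma fixed_point_contains_supertiles:
  obtains q where "q \<ge> 1"
    "\<And>N a u i x. u \<in> \<Lambda>\<^sub>0 a \<Longrightarrow> x \<in> P (q * N) a i \<Longrightarrow> lam ^ (q * N) * u + x \<in> \<Lambda>\<^sub>0 i"
proof -
  obtain q where q: "q \<ge> 1" "(inflate \<rho> lam l ^^ q) \<Lambda>\<^sub>0 = \<Lambda>\<^sub>0"
    using fixed_point by (auto simp: inflation_fixed_point_def)
  have "(inflate \<rho> lam l ^^ (q * N)) \<Lambda>\<^sub>0 = \<Lambda>\<^sub>0" for N
    by (induction N) (simp_all add: funpow_add q(2))
  then have "\<Lambda>\<^sub>0 i = {lam ^ (q * N) * x + s | j x s. x \<in> \<Lambda>\<^sub>0 j \<and> s \<in> P (q * N) j i}" for N i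
    using inflate_funpow[of "q * N" \<Lambda>\<^sub>0 i] by simp
  then have "lam ^ (q * N) * u + x \<in> \<Lambda>\<^sub>0 i" if "u \<in> \<Lambda>\<^sub>0 a" "x \<in> P (q * N) a i" for N a u i x
    using that by (metis (mono_tags, lifting) mem_Collect_eq)
  then show thesis using that[OF q(1)] by blast
qed

text \<open>One occurrence of z would do for the fixed point, but an element of the hull agrees with
  its translates only on bounded windows, so z must occur near every c. It does, because supertiles
  of a high enough level cover the line and each contains the pair; R is a bound for their
  length.\<close>

lemma supertile_differences_relatively_dense:
  assumes "z \<in> supertile_differences i j"
  obtains R where "\<And>c. \<exists>x. \<bar>x - c\<bar> \<le> R \<and> x \<in> \<Lambda>\<^sub>0 i \<and> x + z \<in> \<Lambda>\<^sub>0 j"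
proof -
  obtain n k x y where z: "z = y - x" "x \<in> P n k i" "y \<in> P n k j"
    using assms by (auto simp: supertile_differences_def)
  obtain q where q: "q \<ge> 1"
    "\<And>N a u i x. u \<in> \<Lambda>\<^sub>0 a \<Longrightarrow> x \<in> P (q * N) a i \<Longrightarrow> lam ^ (q * N) * u + x \<in> \<Lambda>\<^sub>0 i"
    using fixed_point_contains_supertiles by blast
  obtain p where p: "\<And>p' i j. p' \<ge> p \<Longrightarrow> P p' j i \<noteq> {}"
    using supertile_contains_all_types by blast
  \<comment> \<open>A multiple of q, so that the fixed point is composed of level-m supertiles, and
    at least n + p, so that each of them contains a level-n supertile of type k.\<close>
  define m where "m = q * (n + p)"
  define p' where "p' = m - n"
  have "n + p \<le> m" using q(1) by (simp add: m_def)
  then have p': "m = n + p'" "p' \<ge> p" by (auto simp: p'_def)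
  have "\<exists>v. \<bar>v - c\<bar> \<le> lam ^ m * Max (range (($) l)) \<and> v \<in> \<Lambda>\<^sub>0 i \<and> v + z \<in> \<Lambda>\<^sub>0 j" for c
  proof -
    obtain a u where u: "u \<in> \<Lambda>\<^sub>0 a" "u \<le> c / lam ^ m" "c / lam ^ m \<le> u + l $ a"
      by (rule tiling_covers)
    obtain s where s: "s \<in> P p' a k" using p[OF p'(2)] by blast
    have x: "lam ^ n * s + x \<in> P m a i" and y: "lam ^ n * s + y \<in> P m a j"
      unfolding p'(1) supertile_add using s z by blast+
    define v where "v = lam ^ m * u + (lam ^ n * s + x)"
    have "v \<in> \<Lambda>\<^sub>0 i" unfolding v_def using q(2)[OF u(1)] x unfolding m_def by blast
    moreover have "lam ^ m * u + (lam ^ n * s + y) \<in> \<Lambda>\<^sub>0 j"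
      using q(2)[OF u(1)] y unfolding m_def by blast
    then have "v + z \<in> \<Lambda>\<^sub>0 j" by (simp add: v_def z(1) algebra_simps)
    moreover have "\<bar>v - c\<bar> \<le> lam ^ m * l $ a"
    proof -
      have "lam ^ m * u \<le> c" "c \<le> lam ^ m * u + lam ^ m * l $ a"
        using u by (simp_all add: field_simps)
      moreover have "0 \<le> v - lam ^ m * u" "v - lam ^ m * u \<le> lam ^ m * l $ a"
        using supertile_bounds[OF x] l_nonneg[of i] unfolding v_def by linarith+
      ultimately show ?thesis by linarith
    qed
    moreover have "lam ^ m * l $ a \<le> lam ^ m * Max (range (($) l))"
      by (intro mult_left_mono) auto
    ultimately show ?thesis by (intro exI[of _ v]) linarith
  qed
  then show thesis using that by blast
qed

text \<open>Legality puts any two tiles into a common supertile, which rules out differences seen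
  only across a seam; the converse is recurrence.\<close>

lemma difference_set_fixed_point: "difference_set \<Lambda>\<^sub>0 i j = supertile_differences i j"
proof
  show "difference_set \<Lambda>\<^sub>0 i j \<subseteq> supertile_differences i j"
  proof
    fix z assume "z \<in> difference_set \<Lambda>\<^sub>0 i j"
    then obtain x y where xy: "z = y - x" "x \<in> \<Lambda>\<^sub>0 i" "y \<in> \<Lambda>\<^sub>0 j"
      by (rule difference_setE)
    define R where "R = max \<bar>x\<bar> \<bar>y\<bar>"
    obtain n k t where t: "\<And>i. \<Lambda>\<^sub>0 i \<inter> {-R..R} \<subseteq> translate t (P n k) i"
      using legal unfolding legal_def by blast
    have "x \<in> {-R..R}" "y \<in> {-R..R}" by (auto simp: R_def)
    then have "x - t \<in> P n k i" "y - t \<in> P n k j"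
      using t xy(2,3) unfolding mem_translate[symmetric] by blast+
    then show "z \<in> supertile_differences i j"
      using supertile_differencesI[of "x - t" n k i "y - t" j] by (simp add: xy(1))
  qed
  show "supertile_differences i j \<subseteq> difference_set \<Lambda>\<^sub>0 i j"
  proof
    fix z assume "z \<in> supertile_differences i j"
    then obtain x where "x \<in> \<Lambda>\<^sub>0 i" "x + z \<in> \<Lambda>\<^sub>0 j"
      using supertile_differences_relatively_dense by metis
    then show "z \<in> difference_set \<Lambda>\<^sub>0 i j"
      using difference_setI[of x \<Lambda>\<^sub>0 i "x + z" j] by simp
  qed
qed

lemma difference_set_hull:
  assumes "\<Lambda> \<in> tiling_hull \<Lambda>\<^sub>0"
  shows "difference_set \<Lambda> i j = supertile_differences i j"
proof
  have close: "\<exists>s t. \<bar>s\<bar> \<le> 1 \<and> (\<forall>i x. \<bar>x\<bar> \<le> r \<longrightarrow> (x - t \<in> \<Lambda>\<^sub>0 i \<longleftrightarrow> x - s \<in> \<Lambda> i))" for r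
  proof -
    \<comment> \<open>This choice gives agreement on a window of radius at least r while the shift
      stays at most 1.\<close>
    define \<epsilon> where "\<epsilon> = 1 / max 1 r"
    have \<epsilon>: "0 < \<epsilon>" "\<epsilon> \<le> 1" "1 / \<epsilon> \<ge> r" by (auto simp: \<epsilon>_def)
    obtain t where "locally_close \<epsilon> \<Lambda> (translate t \<Lambda>\<^sub>0)"
      using assms \<epsilon>(1) unfolding in_tiling_hull_iff by blast
    then obtain s where s: "\<bar>s\<bar> \<le> \<epsilon>"
        "\<forall>i x. \<bar>x\<bar> \<le> 1/\<epsilon> \<longrightarrow> (x \<in> translate t \<Lambda>\<^sub>0 i \<longleftrightarrow> x - s \<in> \<Lambda> i)"
      unfolding locally_close_iff by blast
    have "\<bar>s\<bar> \<le> 1" using s(1) \<epsilon>(2) by linarith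
    moreover have "\<forall>i x. \<bar>x\<bar> \<le> r \<longrightarrow> (x - t \<in> \<Lambda>\<^sub>0 i \<longleftrightarrow> x - s \<in> \<Lambda> i)"
      using s(2) \<epsilon>(3) by (simp add: mem_translate)
    ultimately show ?thesis by blast
  qed
  show "difference_set \<Lambda> i j \<subseteq> supertile_differences i j"
  proof
    fix z assume "z \<in> difference_set \<Lambda> i j"
    then obtain x y where xy: "z = y - x" "x \<in> \<Lambda> i" "y \<in> \<Lambda> j"
      by (rule difference_setE)
    \<comment> \<open>The extra 1 absorbs the shift s.\<close>
    define r where "r = max \<bar>x\<bar> \<bar>y\<bar> + 1"
    obtain s t where "\<bar>s\<bar> \<le> 1"
      and st: "\<And>i x. \<bar>x\<bar> \<le> r \<Longrightarrow> x - t \<in> \<Lambda>\<^sub>0 i \<longleftrightarrow> x - s \<in> \<Lambda> i"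
      using close by metis
    then have "\<bar>x + s\<bar> \<le> r" "\<bar>y + s\<bar> \<le> r" by (auto simp: r_def)
    then have "x + s - t \<in> \<Lambda>\<^sub>0 i" "y + s - t \<in> \<Lambda>\<^sub>0 j"
      using st[of "x + s" i] st[of "y + s" j] xy by simp_all
    then show "z \<in> supertile_differences i j"
      using difference_setI[of "x + s - t" \<Lambda>\<^sub>0 i "y + s - t" j]
      by (simp add: xy(1) difference_set_fixed_point)
  qed
  show "supertile_differences i j \<subseteq> difference_set \<Lambda> i j"
  proof
    fix z assume "z \<in> supertile_differences i j"
    then obtain R where R: "\<And>c. \<exists>x. \<bar>x - c\<bar> \<le> R \<and> x \<in> \<Lambda>\<^sub>0 i \<and> x + z \<in> \<Lambda>\<^sub>0 j"
      using supertile_differences_relatively_dense by blast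
    \<comment> \<open>The window must hold an occurrence within R of its centre together with its
      partner at offset z.\<close>
    define r where "r = R + \<bar>z\<bar>"
    obtain s t where st: "\<And>i x. \<bar>x\<bar> \<le> r \<Longrightarrow> x - t \<in> \<Lambda>\<^sub>0 i \<longleftrightarrow> x - s \<in> \<Lambda> i"
      using close by metis
    obtain x where x: "\<bar>x + t\<bar> \<le> R" "x \<in> \<Lambda>\<^sub>0 i" "x + z \<in> \<Lambda>\<^sub>0 j"
      using R[of "- t"] by auto
    have "\<bar>x + t\<bar> \<le> r" "\<bar>x + z + t\<bar> \<le> r" using x(1) by (auto simp: r_def)
    then have "x + t - s \<in> \<Lambda> i" "x + z + t - s \<in> \<Lambda> j"
      using st[of "x + t" i] st[of "x + z + t" j] x(2,3) by simp_all
    then show "z \<in> difference_set \<Lambda> i j"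
      using difference_setI[of "x + t - s" \<Lambda> i "x + z + t - s" j] by simp
  qed
qed

section \<open>Gap, local finiteness and symmetry of the supertile differences\<close>

lemma supertile_differences_disjoint:
  "z \<in> supertile_differences i j \<Longrightarrow> (i = j \<and> z = 0) \<or> l $ i \<le> z \<or> z \<le> - l $ j"
  using difference_set_disjoint by (simp add: difference_set_fixed_point)

lemma finite_supertile_differences_Icc: "finite (supertile_differences i j \<inter> {-Z..Z})"
  using finite_difference_set_Icc by (simp add: difference_set_fixed_point)

lemma supertile_differences_uminus:
  "- z \<in> supertile_differences i j \<longleftrightarrow> z \<in> supertile_differences j i"
  using difference_set_uminus[of z \<Lambda>\<^sub>0] by (simp add: difference_set_fixed_point)

section \<open>Iterates of the renormalisation operator\<close>

text \<open>The possible positions of a tile of type \<open>m\<close> in level-\<open>N\<close> supertiles, together with the types of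
  the latter.\<close>

definition ancestors :: "nat \<Rightarrow> 'a \<Rightarrow> ('a \<times> real) set" where
  "ancestors N m = (SIGMA i:UNIV. P N i m)"

text \<open>The right-hand side of the equations for the N-th power of the rule; by
  \<open>renorm_Suc\<close> it is the N-fold iterate of \<open>renorm 1\<close>.\<close>

definition renorm :: "nat \<Rightarrow> ('a \<Rightarrow> 'a \<Rightarrow> real \<Rightarrow> real) \<Rightarrow> 'a \<Rightarrow> 'a \<Rightarrow> real \<Rightarrow> real" where
  "renorm N \<nu> m n z = 1 / lam ^ N *
     (\<Sum>p\<in>ancestors N m. \<Sum>q\<in>ancestors N n. \<nu> (fst p) (fst q) ((z + snd p - snd q) / lam ^ N))"

lemma finite_ancestors [simp]: "finite (ancestors N m)"
  by (simp add: ancestors_def finite_supertile)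

lemma ancestors_0: "ancestors 0 m = {(m, 0)}"
  by (auto simp: ancestors_def supertile_0 split: if_splits)

lemma sum_ancestors: "(\<Sum>p\<in>ancestors N m. g p) = (\<Sum>i\<in>UNIV. \<Sum>x\<in>P N i m. g (i, x))"
  by (simp add: ancestors_def sum.Sigma finite_supertile)

lemma renorm_0: "renorm 0 \<nu> = \<nu>"
  by (simp add: renorm_def ancestors_0 fun_eq_iff)

lemma renorm_1:
  "renorm 1 \<nu> m n z = 1 / lam *
     (\<Sum>i\<in>UNIV. \<Sum>j\<in>UNIV. \<Sum>x\<in>T m i. \<Sum>y\<in>T n j. \<nu> i j ((z + x - y) / lam))"
  unfolding renorm_def sum_ancestors supertile_1 fst_conv snd_conv power_one_right
  by (subst (2) sum.swap) (rule refl)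

lemma renormalisation_solutions_iff:
  "\<nu> \<in> renormalisation_solutions \<rho> lam l \<Delta> \<longleftrightarrow>
     (\<forall>i j z. z \<notin> \<Delta> i j \<longrightarrow> \<nu> i j z = 0) \<and> renorm 1 \<nu> = \<nu>"
proof -
  have "\<nu> \<in> renormalisation_solutions \<rho> lam l \<Delta> \<longleftrightarrow>
      (\<forall>i j. {z. \<nu> i j z \<noteq> 0} \<subseteq> \<Delta> i j) \<and> (\<forall>m n z. \<nu> m n z = renorm 1 \<nu> m n z)"
    unfolding renormalisation_solutions_def renorm_1 mem_Collect_eq by (rule refl)
  moreover have "{z. \<nu> i j z \<noteq> 0} \<subseteq> \<Delta> i j \<longleftrightarrow> (\<forall>z. z \<notin> \<Delta> i j \<longrightarrow> \<nu> i j z = 0)" for i j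
    by auto
  moreover have "(\<forall>m n z. \<nu> m n z = renorm 1 \<nu> m n z) \<longleftrightarrow> renorm 1 \<nu> = \<nu>"
    unfolding fun_eq_iff by (intro all_cong1 eq_commute)
  ultimately show ?thesis by (simp only:)
qed

text \<open>Injectivity is the point, since sums over sets would count a position reached twice only
  once. Two decompositions of one position would put the same tile into two inflated tiles whose
  interiors are disjoint.\<close>

lemma ancestors_Suc:
  "bij_betw (\<lambda>(p, i, s). (i, lam * s + snd p)) (SIGMA p:ancestors 1 m. ancestors N (fst p))
     (ancestors (Suc N) m)"
    (is "bij_betw ?h ?A _")
proof (rule bij_betw_imageI)
  have mem: "((a, t), i, s) \<in> ?A \<longleftrightarrow> t \<in> T m a \<and> s \<in> P N i a" for a t i s
    unfolding ancestors_def supertile_1 by simp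
  show "inj_on ?h ?A"
  proof (rule inj_onI)
    fix u v assume uv: "u \<in> ?A" "v \<in> ?A" "?h u = ?h v"
    obtain a t i s where u: "u = ((a, t), i, s)" by (metis surj_pair)
    obtain b t' j s' where v: "v = ((b, t'), j, s')" by (metis surj_pair)
    have t: "t \<in> T m a" "t' \<in> T m b" and s: "s \<in> P N i a" "s' \<in> P N i b"
      and j: "j = i" and eq: "lam * s + t = lam * s' + t'"
      using uv unfolding u v mem by auto
    have "s' - s \<in> supertile_differences a b" using s by (rule supertile_differencesI)
    then have "(a = b \<and> s' - s = 0) \<or> l $ a \<le> s' - s \<or> s' - s \<le> - l $ b"
      by (rule supertile_differences_disjoint)
    then consider "a = b" "s = s'" | "s + l $ a \<le> s'" | "s' + l $ b \<le> s"
      by argo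
    then show "u = v"
    proof cases
      case 1
      then show ?thesis using eq by (simp add: u v j)
    next
      case 2
      then have "lam * (s + l $ a) \<le> lam * s'" by simp
      then have "lam * s + lam * l $ a \<le> lam * s'" by (simp add: distrib_left)
      then show ?thesis
        using displacement_bounds[OF t(1)] displacement_bounds[OF t(2)] eq l_pos[of m] by argo
    next
      case 3
      then have "lam * (s' + l $ b) \<le> lam * s" by simp
      then have "lam * s' + lam * l $ b \<le> lam * s" by (simp add: distrib_left)
      then show ?thesis
        using displacement_bounds[OF t(1)] displacement_bounds[OF t(2)] eq l_pos[of m] by argo
    qed
  qed
  show "?h ` ?A = ancestors (Suc N) m"
  proof (intro equalityI subsetI)
    fix q assume "q \<in> ?h ` ?A"
    then obtain a t i s where "q = (i, lam * s + t)" "((a, t), i, s) \<in> ?A"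
      by auto
    then show "q \<in> ancestors (Suc N) m"
      unfolding mem unfolding ancestors_def supertile_Suc by blast
  next
    fix q assume "q \<in> ancestors (Suc N) m"
    then obtain a t i s where q: "q = (i, lam * s + t)" "((a, t), i, s) \<in> ?A"
      unfolding mem unfolding ancestors_def supertile_Suc by blast
    show "q \<in> ?h ` ?A"
      using q(2) by (rule rev_image_eqI) (simp add: q(1))
  qed
qed

lemma sum_ancestors_Suc:
  "(\<Sum>p\<in>ancestors (Suc N) m. g p)
     = (\<Sum>p\<in>ancestors 1 m. \<Sum>p'\<in>ancestors N (fst p). g (fst p', lam * snd p' + snd p))"
  by (subst sum.reindex_bij_betw[OF ancestors_Suc, symmetric])
    (simp add: sum.Sigma case_prod_unfold del: One_nat_def)

lemma renorm_Suc: "renorm (Suc N) \<nu> = renorm 1 (renorm N \<nu>)"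
proof (intro ext)
  fix m n z
  let ?F = "\<lambda>p p' q q'. \<nu> (fst p') (fst q')
    ((z + (lam * snd p' + snd p) - (lam * snd q' + snd q)) / lam ^ Suc N)"
  have arg: "((z + snd p - snd q) / lam + x - y) / lam ^ N
      = (z + (lam * x + snd p) - (lam * y + snd q)) / lam ^ Suc N" for p q :: "'a \<times> real" and x y
    by (simp add: field_simps)
  have "renorm 1 (renorm N \<nu>) m n z = 1 / lam ^ Suc N *
      (\<Sum>p\<in>ancestors 1 m. \<Sum>q\<in>ancestors 1 n.
        \<Sum>p'\<in>ancestors N (fst p). \<Sum>q'\<in>ancestors N (fst q). ?F p p' q q')"
    unfolding renorm_def[of 1] renorm_def[of N] power_one_right arg
    by (simp add: sum_distrib_left del: One_nat_def)
  also have "\<dots> = 1 / lam ^ Suc N *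
      (\<Sum>p\<in>ancestors 1 m. \<Sum>p'\<in>ancestors N (fst p).
        \<Sum>q\<in>ancestors 1 n. \<Sum>q'\<in>ancestors N (fst q). ?F p p' q q')"
    by (subst (2) sum.swap) (rule refl)
  also have "\<dots> = renorm (Suc N) \<nu> m n z"
    unfolding renorm_def[of "Suc N"] sum_ancestors_Suc fst_conv snd_conv ..
  finally show "renorm (Suc N) \<nu> m n z = renorm 1 (renorm N \<nu>) m n z" ..
qed

lemma renorm_solution: "renorm 1 \<nu> = \<nu> \<Longrightarrow> renorm N \<nu> = \<nu>"
  by (induction N) (simp_all add: renorm_0 renorm_Suc del: One_nat_def)

lemma renorm_mono:
  assumes "\<And>i j z. \<mu> i j z \<le> \<nu> i j z"
  shows "renorm N \<mu> m n z \<le> renorm N \<nu> m n z"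
  unfolding renorm_def by (intro mult_left_mono sum_mono assms) simp

lemma ancestors_bounds:
  assumes "p \<in> ancestors N m"
  shows "0 \<le> snd p" "snd p + l $ m \<le> lam ^ N * l $ fst p"
  using assms supertile_bounds by (auto simp: ancestors_def)

text \<open>Both positions lie in supertiles of length at most \<open>lam ^ N\<close> times the
  largest tile, so division by \<open>lam ^ N\<close> leaves a window that does not grow with
  N.\<close>

lemma ancestors_distance_le:
  assumes p: "p \<in> ancestors N m" and q: "q \<in> ancestors N n"
  shows "\<bar>(z + snd p - snd q) / lam ^ N\<bar> \<le> \<bar>z\<bar> / lam ^ N + Max (range (($) l))"
proof -
  have le: "lam ^ N * l $ i \<le> lam ^ N * Max (range (($) l))" for i
    by (intro mult_left_mono) auto
  have "\<bar>z + snd p - snd q\<bar> \<le> \<bar>z\<bar> + lam ^ N * Max (range (($) l))"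
    using ancestors_bounds[OF p] ancestors_bounds[OF q] le[of "fst p"] le[of "fst q"]
      l_nonneg[of m] l_nonneg[of n] by linarith
  then show ?thesis by (simp add: field_simps)
qed

text \<open>The eigenvector equation for the N-th power of M, expressed by positions; it is what
  cancels the prefactor.\<close>

lemma sum_eigenvector_ancestors:
  assumes r: "M *v r = lam *s r"
  shows "(\<Sum>p\<in>ancestors N m. r $ fst p) = lam ^ N * r $ m"
proof (induction N arbitrary: m)
  case 0
  show ?case by (simp add: ancestors_0)
next
  case (Suc N)
  have "(\<Sum>p\<in>ancestors (Suc N) m. r $ fst p) = lam ^ N * (\<Sum>p\<in>ancestors 1 m. r $ fst p)"
    by (simp add: sum_ancestors_Suc Suc.IH sum_distrib_left del: One_nat_def)
  also have "(\<Sum>p\<in>ancestors 1 m. r $ fst p) = (M *v r) $ m"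
    unfolding sum_ancestors supertile_1
    by (simp add: card_displacements matrix_vector_mult_def)
  finally show ?case by (simp add: r)
qed

section \<open>Existence\<close>

definition diagonal :: "real^'a \<Rightarrow> 'a \<Rightarrow> 'a \<Rightarrow> real \<Rightarrow> real" where
  "diagonal r i j z = (if i = j \<and> z = 0 then r $ i else 0)"

text \<open>For each p only one q can contribute: the tile at offset z in the same
  supertile.\<close>

lemma renorm_diagonal:
  "renorm N (diagonal r) m n z
     = 1 / lam ^ N * (\<Sum>p\<in>ancestors N m. if (fst p, z + snd p) \<in> ancestors N n then r $ fst p else 0)"
proof -
  have "(\<Sum>q\<in>ancestors N n. diagonal r (fst p) (fst q) ((z + snd p - snd q) / lam ^ N))
      = (\<Sum>q\<in>ancestors N n. if q = (fst p, z + snd p) then r $ fst p else 0)" for p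
    by (intro sum.cong) (auto simp: diagonal_def)
  then show ?thesis by (simp add: renorm_def)
qed

lemma renorm_diagonal_bounds:
  assumes r: "M *v r = lam *s r" and pos: "\<And>i. r $ i > 0"
  shows "0 \<le> renorm N (diagonal r) m n z" "renorm N (diagonal r) m n z \<le> r $ m"
    and "renorm N (diagonal r) m m 0 = r $ m"
proof -
  note [simp] = less_imp_le[OF pos]
  show "0 \<le> renorm N (diagonal r) m n z"
    unfolding renorm_diagonal by (intro mult_nonneg_nonneg sum_nonneg) auto
  have "renorm N (diagonal r) m n z \<le> 1 / lam ^ N * (\<Sum>p\<in>ancestors N m. r $ fst p)"
    unfolding renorm_diagonal by (intro mult_left_mono sum_mono) auto
  then show "renorm N (diagonal r) m n z \<le> r $ m"
    by (simp add: sum_eigenvector_ancestors[OF r])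
  have "renorm N (diagonal r) m m 0 = 1 / lam ^ N * (\<Sum>p\<in>ancestors N m. r $ fst p)"
    unfolding renorm_diagonal by simp
  then show "renorm N (diagonal r) m m 0 = r $ m"
    by (simp add: sum_eigenvector_ancestors[OF r])
qed

text \<open>The first step holds because one application reproduces r on the diagonal at 0 and is
  non-negative elsewhere; monotonicity of the operator propagates it.\<close>

lemma incseq_renorm_diagonal:
  assumes r: "M *v r = lam *s r" and pos: "\<And>i. r $ i > 0"
  shows "incseq (\<lambda>N. renorm N (diagonal r) m n z)"
proof (rule incseq_SucI)
  fix N
  show "renorm N (diagonal r) m n z \<le> renorm (Suc N) (diagonal r) m n z"
  proof (induction N arbitrary: m n z)
    case 0
    show ?case
      using renorm_diagonal_bounds[OF assms, of "Suc 0"] by (simp add: renorm_0 diagonal_def[of r m n z])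
  next
    case (Suc N)
    then show ?case
      unfolding renorm_Suc[of N] renorm_Suc[of "Suc N"] by (intro renorm_mono)
  qed
qed

lemma positive_solution:
  assumes r: "M *v r = lam *s r" and pos: "\<And>i. r $ i > 0"
  obtains \<nu> where "\<nu> \<in> renormalisation_solutions \<rho> lam l supertile_differences"
    "\<And>i j z. z \<in> supertile_differences i j \<Longrightarrow> \<nu> i j z > 0" "\<And>i. \<nu> i i 0 = r $ i"
proof -
  let ?f = "\<lambda>N. renorm N (diagonal r)"
  have "\<exists>L. (\<lambda>N. ?f N m n z) \<longlonglongrightarrow> L \<and> (\<forall>N. ?f N m n z \<le> L)" for m n z
    using incseq_convergent[OF incseq_renorm_diagonal[OF assms]] renorm_diagonal_bounds(2)[OF assms]
    by metis
  then obtain \<nu> where lim: "\<And>m n z. (\<lambda>N. ?f N m n z) \<longlonglongrightarrow> \<nu> m n z"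
    and le: "\<And>N m n z. ?f N m n z \<le> \<nu> m n z"
    by metis
  have "(\<lambda>N. ?f (Suc N) m n z) \<longlonglongrightarrow> renorm 1 \<nu> m n z" for m n z
    unfolding renorm_Suc renorm_def[of 1] by (intro tendsto_intros lim)
  then have fixed: "renorm 1 \<nu> = \<nu>"
    using LIMSEQ_Suc[OF lim] LIMSEQ_unique by blast
  have supp: "z \<in> supertile_differences m n" if nz: "\<nu> m n z \<noteq> 0" for m n z
  proof (rule ccontr)
    assume *: "z \<notin> supertile_differences m n"
    have "?f N m n z = 0" for N
    proof -
      have "(fst p, z + snd p) \<notin> ancestors N n" if p: "p \<in> ancestors N m" for p
      proof
        assume "(fst p, z + snd p) \<in> ancestors N n"
        then show False
          using * p supertile_differencesI[of "snd p" N "fst p" m "z + snd p" n]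
          by (auto simp: ancestors_def)
      qed
      then show ?thesis by (simp add: renorm_diagonal)
    qed
    then have "\<nu> m n z = 0" using lim[of m n z] LIMSEQ_unique by (simp add: LIMSEQ_const_iff)
    then show False using nz by simp
  qed
  have positive: "\<nu> m n z > 0" if z: "z \<in> supertile_differences m n" for m n z
  proof -
    obtain N k x y where xy: "z = y - x" "x \<in> P N k m" "y \<in> P N k n"
      using z unfolding supertile_differences_def by blast
    \<comment> \<open>At the level where the pair occurs, the term of \<open>(k, x)\<close> is
      positive, and the limit dominates every iterate.\<close>
    have "0 < ?f N m n z"
      unfolding renorm_diagonal using xy less_imp_le[OF pos]
      by (intro mult_pos_pos sum_pos2[of _ "(k, x)"]) (auto simp: ancestors_def pos finite_supertile)
    then show ?thesis using le[of N m n z] by simp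
  qed
  have "\<nu> i i 0 = r $ i" for i
    using lim[of i i 0] by (simp add: renorm_diagonal_bounds(3)[OF assms] LIMSEQ_const_iff)
  then show thesis
    using that[of \<nu>] fixed supp positive unfolding renormalisation_solutions_iff by blast
qed

section \<open>Uniqueness\<close>

text \<open>The bound is independent of N: subtracting one such position turns the others into
  differences within \<open>{-Z..Z}\<close>.\<close>

lemma card_ancestors_atMost:
  "card {q \<in> ancestors N n. snd q \<le> Z}
     \<le> CARD('a) * card (supertile_differences n n \<inter> {-Z..Z})"
proof -
  let ?K = "supertile_differences n n \<inter> {-Z..Z}"
  have "card {y \<in> P N j n. y \<le> Z} \<le> card ?K" for j
  proof (cases "{y \<in> P N j n. y \<le> Z} = {}")
    case False
    then obtain y0 where y0: "y0 \<in> P N j n" "y0 \<le> Z" by blast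
    have "(\<lambda>y. y - y0) ` {y \<in> P N j n. y \<le> Z} \<subseteq> ?K"
    proof
      fix w assume "w \<in> (\<lambda>y. y - y0) ` {y \<in> P N j n. y \<le> Z}"
      then obtain y where y: "w = y - y0" "y \<in> P N j n" "y \<le> Z" by blast
      have "w \<in> supertile_differences n n"
        unfolding y(1) using y0(1) y(2) by (rule supertile_differencesI)
      then show "w \<in> ?K"
        using y y0 supertile_bounds(1)[OF y(2)] supertile_bounds(1)[OF y0(1)] by simp
    qed
    then show ?thesis
      by (intro card_inj_on_le[of "\<lambda>y. y - y0"]) (auto simp: inj_on_def finite_supertile_differences_Icc)
  qed (simp only: card.empty le0)
  then have "(\<Sum>j\<in>UNIV. card {y \<in> P N j n. y \<le> Z}) \<le> (\<Sum>j\<in>(UNIV :: 'a set). card ?K)"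
    by (intro sum_mono)
  moreover have "{q \<in> ancestors N n. snd q \<le> Z} = (SIGMA j:UNIV. {y \<in> P N j n. y \<le> Z})"
    by (auto simp: ancestors_def)
  ultimately show ?thesis by (simp add: finite_supertile)
qed

text \<open>Here q is near the left end of its supertile. The case of p near its left end is the
  same set with the roles exchanged and z and V negated.\<close>

definition bounded_pairs :: "nat \<Rightarrow> 'a \<Rightarrow> 'a \<Rightarrow> real \<Rightarrow> real set \<Rightarrow> real \<Rightarrow> (('a \<times> real) \<times> 'a \<times> real) set" where
  "bounded_pairs N m n z V Z = {(p, q). p \<in> ancestors N m \<and> q \<in> ancestors N n \<and>
     (z + snd p - snd q) / lam ^ N \<in> V \<and> snd q \<le> Z}"

text \<open>The type of p, the argument in V and q together determine p, so only the choices of q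
  need a bound.\<close>

lemma card_bounded_pairs:
  assumes "finite V"
  shows "card (bounded_pairs N m n z V Z)
    \<le> CARD('a) * (card V * (CARD('a) * card (supertile_differences n n \<inter> {-Z..Z})))"
proof -
  let ?Y = "{q \<in> ancestors N n. snd q \<le> Z}"
  let ?h = "\<lambda>(p, q). (fst p, (z + snd p - snd q) / lam ^ N, q)"
  have "inj_on ?h (bounded_pairs N m n z V Z)"
    by (rule inj_onI) (auto simp: prod_eq_iff)
  moreover have "?h ` bounded_pairs N m n z V Z \<subseteq> UNIV \<times> V \<times> ?Y"
    by (auto simp: bounded_pairs_def)
  ultimately have "card (bounded_pairs N m n z V Z) \<le> card ((UNIV :: 'a set) \<times> V \<times> ?Y)"
    by (rule card_inj_on_le) (simp add: assms)
  also have "\<dots> = CARD('a) * (card V * card ?Y)"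
    by (simp add: card_cartesian_product)
  also have "\<dots> \<le> CARD('a) * (card V * (CARD('a) * card (supertile_differences n n \<inter> {-Z..Z})))"
    by (intro mult_le_mono le_refl card_ancestors_atMost)
  finally show ?thesis .
qed

lemma finite_bounded_pairs: "finite (bounded_pairs N m n z V Z)"
  by (rule finite_subset[of _ "ancestors N m \<times> ancestors N n"]) (auto simp: bounded_pairs_def)

text \<open>Two disjoint level-\<open>N\<close> supertiles contain tiles at distance \<open>z\<close> only near their ends, so the
  number of terms in the \<open>N\<close>-fold iterated equation stays bounded while the prefactor \<open>1 / lam ^ N\<close>
  tends to \<open>0\<close>.\<close>

lemma solution_zero_if_diagonal_zero:
  assumes \<nu>: "\<nu> \<in> renormalisation_solutions \<rho> lam l supertile_differences"
    and diag: "\<And>i. \<nu> i i 0 = 0"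
  shows "\<nu> = 0"
proof -
  have supp: "\<nu> i j w = 0" if "w \<notin> supertile_differences i j" for i j w
    using \<nu> that unfolding renormalisation_solutions_iff by blast
  have iter: "renorm N \<nu> = \<nu>" for N
    using \<nu> renorm_solution unfolding renormalisation_solutions_iff by blast
  have "\<nu> m n z = 0" for m n z
  proof -
    \<comment> \<open>Since \<open>1 \<le> lam ^ N\<close>, this radius contains the arguments of
      all iterated equations at once.\<close>
    define W where "W = \<bar>z\<bar> + Max (range (($) l))"
    define V where "V = (\<Union>i. \<Union>j. supertile_differences i j \<inter> {-W..W})"
    have V: "finite V" unfolding V_def by (intro finite_UN_I finite_supertile_differences_Icc) auto
    define C where "C = (\<Sum>i\<in>UNIV. \<Sum>j\<in>UNIV. \<Sum>w\<in>V. \<bar>\<nu> i j w\<bar>)"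
    have C: "\<bar>\<nu> i j w\<bar> \<le> C" if "w \<in> V" for i j w
    proof -
      have "\<bar>\<nu> i j w\<bar> \<le> (\<Sum>w\<in>V. \<bar>\<nu> i j w\<bar>)"
        using V that by (intro member_le_sum) auto
      also have "\<dots> \<le> (\<Sum>j\<in>UNIV. \<Sum>w\<in>V. \<bar>\<nu> i j w\<bar>)"
        by (intro member_le_sum[of j UNIV "\<lambda>j. \<Sum>w\<in>V. \<bar>\<nu> i j w\<bar>"]) (auto intro: sum_nonneg)
      also have "\<dots> \<le> C"
        unfolding C_def
        by (intro member_le_sum[of i UNIV "\<lambda>i. \<Sum>j\<in>UNIV. \<Sum>w\<in>V. \<bar>\<nu> i j w\<bar>"]) (auto intro: sum_nonneg)
      finally show ?thesis .
    qed
    \<comment> \<open>One summand for each order of the two supertiles on the line; N does not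
      enter.\<close>
    define B where "B = CARD('a) * (card V * (CARD('a) * card (supertile_differences n n \<inter> {-\<bar>z\<bar>..\<bar>z\<bar>})))
      + CARD('a) * (card (uminus ` V) * (CARD('a) * card (supertile_differences m m \<inter> {-\<bar>z\<bar>..\<bar>z\<bar>})))"
    have bound: "\<bar>\<nu> m n z\<bar> \<le> (1 / lam) ^ N * (real B * C)" for N
    proof -
      let ?g = "\<lambda>p q. \<nu> (fst p) (fst q) ((z + snd p - snd q) / lam ^ N)"
      let ?G = "bounded_pairs N m n z V \<bar>z\<bar>
        \<union> prod.swap ` bounded_pairs N n m (- z) (uminus ` V) \<bar>z\<bar>"
      have finG: "finite ?G" by (simp add: finite_bounded_pairs)
      have G_V: "(z + snd p - snd q) / lam ^ N \<in> V" if "(p, q) \<in> ?G" for p q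
        using that
      proof
        assume "(p, q) \<in> bounded_pairs N m n z V \<bar>z\<bar>"
        then show ?thesis by (simp add: bounded_pairs_def)
      next
        assume "(p, q) \<in> prod.swap ` bounded_pairs N n m (- z) (uminus ` V) \<bar>z\<bar>"
        then have "(- z + snd q - snd p) / lam ^ N \<in> uminus ` V"
          by (auto simp: bounded_pairs_def)
        then obtain v where v: "v \<in> V" "(- z + snd q - snd p) / lam ^ N = - v" by blast
        then have "(z + snd p - snd q) / lam ^ N = v" by (simp add: field_simps)
        then show ?thesis using v(1) by simp
      qed
      have in_G: "(p, q) \<in> ?G" if p: "p \<in> ancestors N m" and q: "q \<in> ancestors N n" and nz: "?g p q \<noteq> 0" for p q
      proof -
        obtain i x where px: "p = (i, x)" by fastforce
        obtain j y where qy: "q = (j, y)" by fastforce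
        define w where "w = (z + x - y) / lam ^ N"
        have lamw: "lam ^ N * w = z + x - y" by (simp add: w_def)
        have w: "w \<in> supertile_differences i j" using supp nz by (auto simp: px qy w_def)
        have x: "x \<le> lam ^ N * l $ i" and y: "y \<le> lam ^ N * l $ j"
          using ancestors_bounds(2)[OF p] ancestors_bounds(2)[OF q] l_nonneg[of m] l_nonneg[of n]
          unfolding px qy fst_conv snd_conv by linarith+
        have "1 \<le> lam ^ N" using lam_gt_1 by (simp add: one_le_power)
        then have "\<bar>z\<bar> / lam ^ N \<le> \<bar>z\<bar>" by (simp add: divide_le_eq mult_le_cancel_left1)
        then have "\<bar>w\<bar> \<le> W"
          using ancestors_distance_le[OF p q, of z] by (simp add: W_def w_def px qy)
        then have wV: "w \<in> V" unfolding V_def using w by fastforce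
        have "\<not> (i = j \<and> w = 0)" using nz diag by (auto simp: px qy w_def)
        \<comment> \<open>The supertiles are disjoint. If that of q lies to the right, then q is
          within |z| of its left end; otherwise this holds for p.\<close>
        then have "l $ i \<le> w \<or> w \<le> - l $ j"
          using supertile_differences_disjoint[OF w] by blast
        then show ?thesis
        proof
          assume "l $ i \<le> w"
          then have "lam ^ N * l $ i \<le> lam ^ N * w" by (intro mult_left_mono) auto
          then have "y \<le> \<bar>z\<bar>" using lamw x by linarith
          then have "(p, q) \<in> bounded_pairs N m n z V \<bar>z\<bar>"
            using wV p q by (simp add: bounded_pairs_def px qy w_def)
          then show ?thesis ..
        next
          assume "w \<le> - l $ j"
          then have "lam ^ N * w \<le> lam ^ N * (- l $ j)" by (intro mult_left_mono) auto
          then have "x \<le> \<bar>z\<bar>" using lamw y unfolding mult_minus_right by linarith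
          moreover have "(- z + y - x) / lam ^ N = - w" by (simp add: w_def field_simps)
          ultimately have "(q, p) \<in> bounded_pairs N n m (- z) (uminus ` V) \<bar>z\<bar>"
            using wV p q by (simp add: bounded_pairs_def px qy)
          then have "(p, q) \<in> prod.swap ` bounded_pairs N n m (- z) (uminus ` V) \<bar>z\<bar>"
            by (rule rev_image_eqI) simp
          then show ?thesis ..
        qed
      qed
      have "card ?G \<le> card (bounded_pairs N m n z V \<bar>z\<bar>)
          + card (prod.swap ` bounded_pairs N n m (- z) (uminus ` V) \<bar>z\<bar>)"
        by (rule card_Un_le)
      also have "\<dots> \<le> card (bounded_pairs N m n z V \<bar>z\<bar>) + card (bounded_pairs N n m (- z) (uminus ` V) \<bar>z\<bar>)"
        by (intro add_left_mono card_image_le finite_bounded_pairs)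
      also have "\<dots> \<le> B"
        unfolding B_def by (intro add_mono card_bounded_pairs V finite_imageI)
      finally have cardG: "card ?G \<le> B" .
      have "\<bar>\<nu> m n z\<bar> = (1 / lam) ^ N * \<bar>\<Sum>p\<in>ancestors N m. \<Sum>q\<in>ancestors N n. ?g p q\<bar>"
        by (subst iter[of N, symmetric]) (simp add: renorm_def abs_mult power_one_over)
      also have "(\<Sum>p\<in>ancestors N m. \<Sum>q\<in>ancestors N n. ?g p q)
          = (\<Sum>(p, q)\<in>ancestors N m \<times> ancestors N n. ?g p q)"
        by (simp add: sum.cartesian_product)
      also have "\<dots> = (\<Sum>(p, q)\<in>(ancestors N m \<times> ancestors N n) \<inter> ?G. ?g p q)"
        using in_G by (intro sum.mono_neutral_right) (auto simp del: Un_iff)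
      also have "\<bar>\<dots>\<bar> \<le> (\<Sum>(p, q)\<in>(ancestors N m \<times> ancestors N n) \<inter> ?G. \<bar>?g p q\<bar>)"
        by (rule order_trans[OF sum_abs]) (simp add: case_prod_unfold)
      also have "\<dots> \<le> (\<Sum>(p, q)\<in>?G. \<bar>?g p q\<bar>)"
        by (intro sum_mono2 finG) auto
      also have "\<dots> \<le> real (card ?G) * C"
      proof (rule sum_bounded_above)
        fix u assume "u \<in> ?G"
        moreover obtain p q where "u = (p, q)" by (rule prod.exhaust)
        ultimately show "(case u of (p, q) \<Rightarrow> \<bar>?g p q\<bar>) \<le> C"
          using C G_V[of p q] by (simp only: prod.case)
      qed
      also have "\<dots> \<le> real B * C"
        using cardG by (intro mult_right_mono) (auto simp: C_def intro!: sum_nonneg)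
      finally show ?thesis by (simp add: mult_left_mono)
    qed
    have "(\<lambda>N. (1 / lam) ^ N * (real B * C)) \<longlonglongrightarrow> 0 * (real B * C)"
      using lam_gt_1 by (intro tendsto_mult tendsto_const LIMSEQ_realpow_zero) auto
    then have "\<bar>\<nu> m n z\<bar> \<le> 0 * (real B * C)"
      by (rule LIMSEQ_le_const) (use bound in blast)
    then show ?thesis by simp
  qed
  then show ?thesis by (simp add: fun_eq_iff)
qed

section \<open>The solution space\<close>

lemma solutions_mono:
  assumes "\<And>i j. \<Delta> i j \<subseteq> \<Delta>' i j"
  shows "renormalisation_solutions \<rho> lam l \<Delta> \<subseteq> renormalisation_solutions \<rho> lam l \<Delta>'"
  using assms unfolding renormalisation_solutions_iff subset_iff by blast

lemma subspace_solutions: "family.subspace (renormalisation_solutions \<rho> lam l \<Delta>)"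
proof (rule family.subspaceI)
  show "0 \<in> renormalisation_solutions \<rho> lam l \<Delta>"
    by (simp add: renormalisation_solutions_def)
next
  fix \<mu> \<nu>
  assume "\<mu> \<in> renormalisation_solutions \<rho> lam l \<Delta>" "\<nu> \<in> renormalisation_solutions \<rho> lam l \<Delta>"
  moreover have "renorm 1 (\<mu> + \<nu>) = renorm 1 \<mu> + renorm 1 \<nu>"
    by (intro ext) (simp add: renorm_def sum.distrib distrib_left)
  ultimately show "\<mu> + \<nu> \<in> renormalisation_solutions \<rho> lam l \<Delta>"
    unfolding renormalisation_solutions_iff by simp
next
  fix c \<nu>
  assume "\<nu> \<in> renormalisation_solutions \<rho> lam l \<Delta>"
  moreover have "renorm 1 (scale_family c \<nu>) = scale_family c (renorm 1 \<nu>)"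
    by (intro ext) (simp add: renorm_def scale_family_apply sum_distrib_left ac_simps)
  ultimately show "scale_family c \<nu> \<in> renormalisation_solutions \<rho> lam l \<Delta>"
    unfolding renormalisation_solutions_iff by (simp add: scale_family_apply)
qed

lemma solution_zero_if_window_zero:
  assumes \<nu>: "renorm 1 \<nu> = \<nu>"
    and window: "\<And>i j w. \<bar>w\<bar> \<le> 1 + Max (range (($) l)) \<Longrightarrow> \<nu> i j w = 0"
  shows "\<nu> = 0"
proof -
  have "\<nu> m n z = 0" for m n z
  proof -
    \<comment> \<open>At this level z contributes at most 1 to the arguments, hence the 1 in the
      window.\<close>
    obtain N where "\<bar>z\<bar> < lam ^ N" using real_arch_pow[OF lam_gt_1] by blast
    then have "\<bar>z\<bar> / lam ^ N \<le> 1" by simp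
    then have "\<bar>(z + snd p - snd q) / lam ^ N\<bar> \<le> 1 + Max (range (($) l))"
      if "p \<in> ancestors N m" "q \<in> ancestors N n" for p q
      using ancestors_distance_le[OF that, of z] by linarith
    then have "renorm N \<nu> m n z = 0"
      by (simp add: renorm_def window)
    then show ?thesis by (simp add: renorm_solution[OF \<nu>])
  qed
  then show ?thesis by (simp add: fun_eq_iff)
qed

lemma finite_dimensional_solutions:
  assumes "locally_finite_set (\<Union>i. \<Union>j. \<Delta> i j)"
  shows "\<exists>B. finite B \<and> family.span B = renormalisation_solutions \<rho> lam l \<Delta>"
proof -
  define R where "R = 1 + Max (range (($) l))"
  define F where "F = {(i, j, z). z \<in> \<Delta> i j \<and> \<bar>z\<bar> \<le> R}"
  have "finite ((\<Union>i. \<Union>j. \<Delta> i j) \<inter> {-R..R})"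
    using assms unfolding locally_finite_set_def by blast
  then have "finite ((UNIV :: 'a set) \<times> (UNIV :: 'a set) \<times> ((\<Union>i. \<Union>j. \<Delta> i j) \<inter> {-R..R}))"
    by simp
  then have "finite F" by (rule rev_finite_subset) (auto simp: F_def abs_le_iff)
  then show ?thesis
  proof (rule finite_span_if_determined_on_finite[OF _ subspace_solutions])
    fix \<nu> assume \<nu>: "\<nu> \<in> renormalisation_solutions \<rho> lam l \<Delta>" and F: "\<forall>(i, j, z)\<in>F. \<nu> i j z = 0"
    have "\<nu> i j z = 0" if "\<bar>z\<bar> \<le> R" for i j z
      using \<nu> F that unfolding renormalisation_solutions_iff F_def by fast
    then show "\<nu> = 0"
      using \<nu> solution_zero_if_window_zero unfolding R_def renormalisation_solutions_iff by blast
  qed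
qed

section \<open>Solutions on the full difference sets\<close>

lemma diagonal_eigenvector:
  assumes \<nu>: "\<nu> \<in> renormalisation_solutions \<rho> lam l supertile_differences"
  shows "M *v (\<chi> i. \<nu> i i 0) = lam *s (\<chi> i. \<nu> i i 0)"
proof -
  have supp: "w \<in> supertile_differences i j" if "\<nu> i j w \<noteq> 0" for i j w
    using \<nu> that unfolding renormalisation_solutions_iff by blast
  have fixed: "renorm 1 \<nu> = \<nu>"
    using \<nu> unfolding renormalisation_solutions_iff by blast
  have "(\<Sum>j\<in>UNIV. M $ m $ j * \<nu> j j 0) = lam * \<nu> m m 0" for m
  proof -
    \<comment> \<open>At z = 0 a non-zero term with q different from p would put one and the same
      tile of type m into two disjoint supertiles.\<close>
    have off: "\<nu> (fst p) (fst q) ((snd p - snd q) / lam) = 0"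
      if p: "p \<in> ancestors 1 m" and q: "q \<in> ancestors 1 m" and "q \<noteq> p" for p q
    proof (rule ccontr)
      define w where "w = (snd p - snd q) / lam"
      have lamw: "lam * w = snd p - snd q" by (simp add: w_def)
      assume "\<nu> (fst p) (fst q) ((snd p - snd q) / lam) \<noteq> 0"
      then have "w \<in> supertile_differences (fst p) (fst q)"
        using supp by (simp add: w_def)
      then consider "fst p = fst q" "w = 0" | "l $ fst p \<le> w" | "w \<le> - l $ fst q"
        using supertile_differences_disjoint by blast
      then show False
      proof cases
        case 1
        then show ?thesis using \<open>q \<noteq> p\<close> lamw by (simp add: prod_eq_iff)
      next
        case 2
        then have "lam * l $ fst p \<le> lam * w" by simp
        then show ?thesis
          using lamw ancestors_bounds[OF p] ancestors_bounds[OF q] l_pos[of m]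
          unfolding power_one_right by linarith
      next
        case 3
        then have "lam * w \<le> lam * (- l $ fst q)" by (intro mult_left_mono) auto
        then show ?thesis
          using lamw ancestors_bounds[OF p] ancestors_bounds[OF q] l_pos[of m]
          unfolding power_one_right mult_minus_right by linarith
      qed
    qed
    have "\<nu> m m 0 = renorm 1 \<nu> m m 0" by (simp only: fixed)
    also have "\<dots> = 1 / lam * (\<Sum>p\<in>ancestors 1 m. \<Sum>q\<in>ancestors 1 m.
        if q = p then \<nu> (fst p) (fst p) 0 else 0)"
      unfolding renorm_def power_one_right
      by (intro arg_cong[of _ _ "\<lambda>x. 1 / lam * x"] sum.cong refl) (auto simp: off simp del: One_nat_def)
    also have "\<dots> = 1 / lam * (\<Sum>p\<in>ancestors 1 m. \<nu> (fst p) (fst p) 0)"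
      by (intro arg_cong[of _ _ "\<lambda>x. 1 / lam * x"] sum.cong refl) (subst sum.delta, simp_all)
    also have "\<dots> = 1 / lam * (\<Sum>j\<in>UNIV. M $ m $ j * \<nu> j j 0)"
      by (simp add: sum_ancestors supertile_1 card_displacements del: One_nat_def)
    finally show ?thesis by simp
  qed
  then show ?thesis by (simp add: vec_eq_iff matrix_vector_mult_def)
qed

text \<open>The equations are invariant under exchanging the indices and reflecting z. On a
  one-dimensional solution space this yields the symmetry relation.\<close>

lemma renorm_flip: "renorm N (\<lambda>i j z. \<nu> j i (- z)) m n z = renorm N \<nu> n m (- z)"
proof -
  have arg: "- ((z + x - y) / lam ^ N) = (- z + y - x) / lam ^ N" for x y
    by (simp add: minus_divide_left)
  show ?thesis unfolding renorm_def arg by (subst sum.swap) (rule refl)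
qed

lemma flip_solution:
  assumes "\<nu> \<in> renormalisation_solutions \<rho> lam l supertile_differences"
  shows "(\<lambda>i j z. \<nu> j i (- z)) \<in> renormalisation_solutions \<rho> lam l supertile_differences"
proof -
  have "z \<in> supertile_differences i j" if "\<nu> j i (- z) \<noteq> 0" for i j z
    using assms that supertile_differences_uminus[of z j i]
    unfolding renormalisation_solutions_iff by blast
  moreover have "renorm 1 (\<lambda>i j z. \<nu> j i (- z)) = (\<lambda>i j z. \<nu> j i (- z))"
    using assms unfolding renormalisation_solutions_iff fun_eq_iff renorm_flip by blast
  ultimately show ?thesis unfolding renormalisation_solutions_iff by blast
qed

lemma normalised_solution:
  obtains \<nu> where
    "renormalisation_solutions \<rho> lam l supertile_differences = family.span {\<nu>}"
    "\<And>i j z. z \<in> supertile_differences i j \<Longrightarrow> \<nu> i j z > 0"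
    "(\<Sum>i\<in>UNIV. \<nu> i i 0) = 1" "\<And>i j z. \<nu> i j (- z) = \<nu> j i z"
proof -
  let ?Sol = "renormalisation_solutions \<rho> lam l supertile_differences"
  obtain s :: "real^'a" where s: "\<And>i. s $ i > 0" "M *v s = lam *s s"
    using positive_eigenvector by blast
  define \<sigma> where "\<sigma> = (\<Sum>i\<in>UNIV. s $ i)"
  have \<sigma>: "\<sigma> > 0" unfolding \<sigma>_def using s(1) by (intro sum_pos) auto
  \<comment> \<open>Scaled so that the resulting solution, whose diagonal is r, meets the
    normalisation.\<close>
  define r where "r = (1 / \<sigma>) *s s"
  have r: "M *v r = lam *s r" "\<And>i. r $ i > 0"
    using s \<sigma> by (simp_all add: r_def vec.scale)
  have sum_r: "(\<Sum>i\<in>UNIV. r $ i) = 1"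
    using \<sigma> by (simp add: r_def \<sigma>_def flip: sum_divide_distrib)
  obtain \<nu> where \<nu>: "\<nu> \<in> ?Sol" "\<And>i j z. z \<in> supertile_differences i j \<Longrightarrow> \<nu> i j z > 0"
      "\<And>i. \<nu> i i 0 = r $ i"
    using positive_solution[OF r] by metis
  have unique: "\<exists>c. \<mu> = scale_family c \<nu>" if \<mu>: "\<mu> \<in> ?Sol" for \<mu>
  proof -
    \<comment> \<open>Both diagonals are eigenvectors, so a multiple of \<open>\<nu>\<close> removes
      the diagonal of \<open>\<mu>\<close>.\<close>
    obtain c where c: "(\<chi> i. \<mu> i i 0) = c *s r"
      using eigenvector_unique[OF r diagonal_eigenvector[OF \<mu>]] by blast
    have "\<mu> - scale_family c \<nu> = 0"
    proof (rule solution_zero_if_diagonal_zero)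
      show "\<mu> - scale_family c \<nu> \<in> ?Sol"
        using subspace_solutions \<mu> \<nu>(1) by (intro family.subspace_diff family.subspace_scale)
      show "(\<mu> - scale_family c \<nu>) i i 0 = 0" for i
        using arg_cong[OF c, of "\<lambda>v. v $ i"] by (simp add: scale_family_apply \<nu>(3))
    qed
    then show ?thesis by auto
  qed
  have sum1: "(\<Sum>i\<in>UNIV. \<nu> i i 0) = 1" using sum_r by (simp add: \<nu>(3))
  have "?Sol = family.span {\<nu>}"
    using unique family.subspace_scale[OF subspace_solutions \<nu>(1)]
    unfolding family.span_singleton by blast
  moreover have "\<nu> i j (- z) = \<nu> j i z" for i j z
  proof -
    \<comment> \<open>The flip leaves the diagonal at 0 unchanged, and its sum is 1, so the factor c
      can only be 1.\<close>
    obtain c where c: "(\<lambda>i j z. \<nu> j i (- z)) = scale_family c \<nu>"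
      using unique[OF flip_solution[OF \<nu>(1)]] by blast
    have eq: "\<nu> j i (- z) = c * \<nu> i j z" for i j z
      using arg_cong[OF c, of "\<lambda>F. F i j z"] by (simp add: scale_family_apply)
    have "\<nu> k k 0 = c * \<nu> k k 0" for k
      using eq[of k k 0] unfolding minus_zero .
    then have "(\<Sum>k\<in>UNIV. \<nu> k k 0) = c * (\<Sum>k\<in>UNIV. \<nu> k k 0)"
      unfolding sum_distrib_left by (intro sum.cong refl)
    then have "c = 1" unfolding sum1 by simp
    then show ?thesis using eq[where i = j and j = i and z = z] by simp
  qed
  ultimately show thesis using \<nu>(2) sum1 by (intro that)
qed

end

theorem theorem3p19:
  fixes \<rho> :: "'a::finite \<Rightarrow> 'a list" and lam :: real and l :: "real^'a"
    and \<Lambda>\<^sub>0 \<Lambda> :: "'a pointset" and S :: "'a \<Rightarrow> 'a \<Rightarrow> real set"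
  assumes "primitive_inflation \<rho> lam l"
    and "inflation_fixed_point \<rho> lam l \<Lambda>\<^sub>0"
    and "\<Lambda> \<in> tiling_hull \<Lambda>\<^sub>0"
    and "S = difference_set \<Lambda>"
  shows
    "(\<forall>\<Delta>. locally_finite_set (\<Union>i. \<Union>j. \<Delta> i j) \<and> 0 \<in> (\<Union>i. \<Union>j. \<Delta> i j) \<longrightarrow>
        family.subspace (renormalisation_solutions \<rho> lam l \<Delta>) \<and>
        (\<exists>B. finite B \<and> family.span B = renormalisation_solutions \<rho> lam l \<Delta>) \<and>
        ((\<forall>i j. S i j \<subseteq> \<Delta> i j) \<longrightarrow> renormalisation_solutions \<rho> lam l \<Delta> \<noteq> {0}))
     \<and>
     (family.dim (renormalisation_solutions \<rho> lam l S) = 1 \<and>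
      (\<exists>!\<nu>. \<nu> \<in> renormalisation_solutions \<rho> lam l S \<and> (\<Sum>i\<in>UNIV. \<nu> i i 0) = 1) \<and>
      (\<forall>\<nu>. \<nu> \<in> renormalisation_solutions \<rho> lam l S \<and> (\<Sum>i\<in>UNIV. \<nu> i i 0) = 1 \<longrightarrow>
         (\<forall>i j. \<forall>z\<in>S i j. 0 < \<nu> i j z) \<and>
         (\<forall>i j z. \<nu> i j (- z) = \<nu> j i z)))
     \<and>
     (\<forall>\<Delta>. (\<forall>i j. \<Delta> i j \<subseteq> S i j) \<and> (\<exists>i j. \<Delta> i j \<subset> S i j) \<longrightarrow>
        renormalisation_solutions \<rho> lam l \<Delta> = {0})"
proof -
  interpret inflation_tiling \<rho> lam l \<Lambda>\<^sub>0
    using assms(1,2) by unfold_locales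
  have S: "S = supertile_differences"
    using difference_set_hull[OF assms(3)] by (simp add: assms(4) fun_eq_iff)
  obtain \<nu> where span: "renormalisation_solutions \<rho> lam l S = family.span {\<nu>}"
    and pos: "\<And>i j z. z \<in> S i j \<Longrightarrow> \<nu> i j z > 0"
    and sum1: "(\<Sum>i\<in>UNIV. \<nu> i i 0) = 1" and sym: "\<And>i j z. \<nu> i j (- z) = \<nu> j i z"
    unfolding S using normalised_solution by blast
  have \<nu>: "\<nu> \<in> renormalisation_solutions \<rho> lam l S"
    unfolding span by (simp add: family.span_base)
  have nonzero: "\<nu> \<noteq> 0" using sum1 by auto
  have multiple: "\<exists>c. \<mu> = scale_family c \<nu>" if "\<mu> \<in> renormalisation_solutions \<rho> lam l S" for \<mu>
    using that unfolding span family.span_singleton by blast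
  have unique: "\<mu> = \<nu>"
    if \<mu>: "\<mu> \<in> renormalisation_solutions \<rho> lam l S" "(\<Sum>i\<in>UNIV. \<mu> i i 0) = 1" for \<mu>
  proof -
    obtain c where c: "\<mu> = scale_family c \<nu>" using multiple[OF \<mu>(1)] by blast
    have "c = 1"
      using \<mu>(2) by (simp add: c scale_family_apply sum1 flip: sum_distrib_left)
    then show ?thesis by (simp add: c)
  qed
  have dim: "family.dim (renormalisation_solutions \<rho> lam l S) = 1"
    unfolding span
    by (subst family.dim_span_eq_card_independent) (simp_all add: nonzero)
  have proper: "renormalisation_solutions \<rho> lam l \<Delta> = {0}"
    if \<Delta>: "\<And>i j. \<Delta> i j \<subseteq> S i j" "\<Delta> i j \<subset> S i j" for \<Delta> i j
  proof (intro equalityI subsetI)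
    fix \<mu> assume \<mu>: "\<mu> \<in> renormalisation_solutions \<rho> lam l \<Delta>"
    then obtain c where c: "\<mu> = scale_family c \<nu>"
      using multiple solutions_mono[of \<Delta> S] \<Delta>(1) by blast
    \<comment> \<open>Strict positivity of \<open>\<nu>\<close> at a removed point leaves only the
      zero multiple.\<close>
    obtain z where z: "z \<in> S i j" "z \<notin> \<Delta> i j" using \<Delta>(2) by blast
    have "\<mu> i j z = 0" using \<mu> z(2) unfolding renormalisation_solutions_iff by blast
    then have "c = 0" using pos[OF z(1)] by (simp add: c scale_family_apply)
    then show "\<mu> \<in> {0}" by (simp add: c)
  next
    fix \<mu> :: "'a \<Rightarrow> 'a \<Rightarrow> real \<Rightarrow> real" assume "\<mu> \<in> {0}"
    then show "\<mu> \<in> renormalisation_solutions \<rho> lam l \<Delta>"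
      using family.subspace_0[OF subspace_solutions] by blast
  qed
  have nontrivial: "renormalisation_solutions \<rho> lam l \<Delta> \<noteq> {0}"
    if "\<And>i j. S i j \<subseteq> \<Delta> i j" for \<Delta>
    using solutions_mono[of S \<Delta>] that \<nu> nonzero by blast
  show ?thesis
  proof (intro conjI)
    show "\<exists>!\<nu>. \<nu> \<in> renormalisation_solutions \<rho> lam l S \<and> (\<Sum>i\<in>UNIV. \<nu> i i 0) = 1"
      using \<nu> sum1 unique by blast
    show "\<forall>\<mu>. \<mu> \<in> renormalisation_solutions \<rho> lam l S \<and> (\<Sum>i\<in>UNIV. \<mu> i i 0) = 1 \<longrightarrow>
        (\<forall>i j. \<forall>z\<in>S i j. 0 < \<mu> i j z) \<and> (\<forall>i j z. \<mu> i j (- z) = \<mu> j i z)"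
      using unique pos sym by blast
    show "\<forall>\<Delta>. locally_finite_set (\<Union>i. \<Union>j. \<Delta> i j) \<and> 0 \<in> (\<Union>i. \<Union>j. \<Delta> i j) \<longrightarrow>
        family.subspace (renormalisation_solutions \<rho> lam l \<Delta>) \<and>
        (\<exists>B. finite B \<and> family.span B = renormalisation_solutions \<rho> lam l \<Delta>) \<and>
        ((\<forall>i j. S i j \<subseteq> \<Delta> i j) \<longrightarrow> renormalisation_solutions \<rho> lam l \<Delta> \<noteq> {0})"
      by (intro allI impI conjI subspace_solutions finite_dimensional_solutions nontrivial) simp_all
    show "\<forall>\<Delta>. (\<forall>i j. \<Delta> i j \<subseteq> S i j) \<and> (\<exists>i j. \<Delta> i j \<subset> S i j) \<longrightarrow>
        renormalisation_solutions \<rho> lam l \<Delta> = {0}"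
    proof (intro allI impI, elim conjE exE)
      fix \<Delta> i j assume "\<forall>i j. \<Delta> i j \<subseteq> S i j" "\<Delta> i j \<subset> S i j"
      then show "renormalisation_solutions \<rho> lam l \<Delta> = {0}" using proper[of \<Delta> i j] by simp
    qed
  qed (rule dim)
qed

end
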